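(* Let $L_A=(A,\mathsf{Act}_\tau,\to_A)$ and $L_B=(B,\mathsf{Act}_\tau,\to_B)$ be LTSs in $\mathrm{Fdb}$. For every $p\in A$ and $q\in B$, $p\sqsubseteq_{\mathrm{must}}q$ if and only if $\mathrm{FW}(p)\preccurlyeq_{\mathsf{MS}}\mathrm{FW}(q)$.
   Context: Actions. Fix a countable set $\mathcal N$ of names (inputs $a,b,\dots$), co-names $\overline{\mathcal N}=\{\bar a:a\in\mathcal N\}$ (outputs), and $\tau$; $\mathsf{Act}=\mathcal N\cup\overline{\mathcal N}$ (ranged over by $\mu$), $\mathsf{Act}_\tau=\mathsf{Act}\cup\{\tau\}$ (ranged over by $\alpha$), $\bar{\bar a}=a$. An LTS is $(A,\mathsf{Act}_\tau,\to)$ with decidable transition relation; $p$ is stable if not $p\xrightarrow{\tau}$; $O(p)=\{\bar a: p\xrightarrow{\bar a}\}$, assumed finite for every $p$. $\mathrm{Fdb}$: an LTS is in $\mathrm{Fdb}$ if for all states and $a\in\mathcal N$: (Output-commutativity) $p\xrightarrow{\bar a}p'\xrightarrow{\alpha}q$ implies $p\xrightarrow{\alpha}p''\xrightarrow{\bar a}q$ for some $p''$; (Feedback) $p\xrightarrow{\bar a}p'\xrightarrow{a}q$ implies $p\xrightarrow{\tau}q$; (Output-determinacy) $p\xrightarrow{\bar a}p'$, $p\xrightarrow{\bar a}p''$ imply $p'=p''$; (Output-tau) $p\xrightarrow{\bar a}p'$ and $p\xrightarrow{\tau}p''$ imply either some $q$ has $p'\xrightarrow{\tau}q$ and $p''\xrightarrow{\bar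 a}q$, or $p'\xrightarrow{a}p''$; (Output-confluence) $p\xrightarrow{\bar a}p'$, $p\xrightarrow{\alpha}p''$, $\alpha\notin\{\bar a,\tau\}$ imply some $q$ has $p'\xrightarrow{\alpha}q$ and $p''\xrightarrow{\bar a}q$; (Backward-output-determinacy) $p'\xrightarrow{\bar a}p$ and $p''\xrightarrow{\bar a}p$ imply $p'=p''$. Weak transitions and convergence. $p\overset{s}{\Longrightarrow}p'$ ($s\in\mathsf{Act}^*$) is the least relation with $p\overset{\varepsilon}{\Longrightarrow}p$; $p\xrightarrow{\tau}p''\overset{s}{\Longrightarrow}p'$ implies $p\overset{s}{\Longrightarrow}p'$; $p\xrightarrow{\mu}p''\overset{s}{\Longrightarrow}p'$ implies $p\overset{\mu s}{\Longrightarrow}p'$. $p\downarrow$: every $\tau$-sequence from $p$ is finite. $p\Downarrow s$: least relation with $p\Downarrow\varepsilon$ if $p\downarrow$, and $p\Downarrow\mu s$ if $p\downarrow$ and $p'\Downarrow s$ whenever $p\overset{\mu}{\Longrightarrow}p'$. Must-preorder. For server $p$ and client $r$, $(p,r)$ reduces by: $p\xrightarrow{\tau}p'$ gives $(p,r)\to(p',r)$; $r\xrightarrow{\tau}r'$ gives $(p,r)\to(p,r')$; $p\xrightarrow{\mu}p'$ and $r\xrightarrow{\bar\mu}r'$ give $(p,r)\to(p',r')$. Maximal computations are infinite or end in a state with no reduction. A client LTS is $C\in\mathrm{Fdb}$ with a decidable predicate $\mathrm{good}$ on $C$ such that $r\xrightarrow{\bar a}r'$ implies ($\mathrm{good}(r)\iff\mathrm{good}(r')$).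 $\mathrm{must}(p,r)$: every maximal computation from $(p,r)$ contains some $(p_i,r_i)$ with $\mathrm{good}(r_i)$. $p\sqsubseteq_{\mathrm{must}}q$ iff for every client LTS $(C,\mathrm{good})$ and $r\in C$, $\mathrm{must}(p,r)$ implies $\mathrm{must}(q,r)$. Forwarding lifting. For an LTS $L$ with states $A$, $\mathrm{FW}(L)$ has states $p\triangleright M$ ($p\in A$, $M$ a finite multiset of co-names) and transitions: $p\xrightarrow{\alpha}p'$ gives $p\triangleright M\xrightarrow{\alpha}p'\triangleright M$; $p\xrightarrow{a}p'$ gives $p\triangleright(\{\bar a\}\uplus M)\xrightarrow{\tau}p'\triangleright M$; $p\triangleright(\{\bar a\}\uplus M)\xrightarrow{\bar a}p\triangleright M$; $p\triangleright M\xrightarrow{a}p\triangleright(\{\bar a\}\uplus M)$. $\mathrm{FW}(p)$ denotes $p\triangleright\varnothing$. Must-set preorder. For a state $p$ and a finite set $X\subseteq\mathsf{Act}$, $p$ must $X$ iff for every $p'$ with $p\overset{\varepsilon}{\Longrightarrow}p'$ there is $\mu\in X$ with $p'\overset{\mu}{\Longrightarrow}$. For a set $S$ of states, $S$ must $X$ iff every element of $S$ must $X$. Let $\mathrm{after}(p,s)=\{p': p\overset{s}{\Longrightarrow}p'\}$. $p\preccurlyeq_{\mathsf{cnv}}q$ iff for all $s\in\mathsf{Act}^*$, $p\Downarrow s$ implies $q\Downarrow s$. $p\preccurlyeq_{\mathsf{M}}q$ iff for all $s\in\mathsf{Act}^*$ with $p\Downarrow s$ and all finite $X\subseteq\mathsf{Act}$,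 $\mathrm{after}(p,s)$ must $X$ implies $\mathrm{after}(q,s)$ must $X$. $p\preccurlyeq_{\mathsf{MS}}q$ iff $p\preccurlyeq_{\mathsf{cnv}}q$ and $p\preccurlyeq_{\mathsf{M}}q$ (each predicate computed in the LTS of its argument).
   Formalization: The claim fails as stated; two conditions are added: in L_A every state has finitely many successors for each action, and clients admit no infinite sequence of consecutive outputs. *)

theory Defs
  imports "HOL-Library.Multiset" "HOL-Library.Countable"
begin

datatype 'n act = In 'n | Out 'n

fun co :: "'n act \<Rightarrow> 'n act" where
  "co (In a) = Out a"
| "co (Out a) = In a"

datatype 'n label = Tau | Vis "'n act"

type_synonym ('s, 'n) trans = "'s \<Rightarrow> 'n label \<Rightarrow> 's \<Rightarrow> bool"

definition outputs :: "('s, 'n) trans \<Rightarrow> 's \<Rightarrow> 'n act set" where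
  "outputs step p = {Out a | a. \<exists>p'. step p (Vis (Out a)) p'}"

text \<open>States form a whole type; a system on a smaller carrier is obtained by giving
  the remaining states no transitions, which preserves every axiom below. Decidability of
  the transition relation has no content in classical logic.\<close>

locale lts =
  fixes step :: "('s, 'n) trans"
  assumes finite_outputs: "finite (outputs step p)"

locale Fdb = lts step for step :: "('s, 'n) trans" +
  assumes output_commutativity:
      "\<lbrakk>step p (Vis (Out a)) p'; step p' \<alpha> q\<rbrakk> \<Longrightarrow> \<exists>p''. step p \<alpha> p'' \<and> step p'' (Vis (Out a)) q"
    and feedback:
      "\<lbrakk>step p (Vis (Out a)) p'; step p' (Vis (In a)) q\<rbrakk> \<Longrightarrow> step p Tau q"
    and output_determinacy:
      "\<lbrakk>step p (Vis (Out a)) p'; step p (Vis (Out a)) p''\<rbrakk> \<Longrightarrow> p' = p''"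
    and output_tau:
      "\<lbrakk>step p (Vis (Out a)) p'; step p Tau p''\<rbrakk>
        \<Longrightarrow> (\<exists>q. step p' Tau q \<and> step p'' (Vis (Out a)) q) \<or> step p' (Vis (In a)) p''"
    and output_confluence:
      "\<lbrakk>step p (Vis (Out a)) p'; step p \<alpha> p''; \<alpha> \<notin> {Vis (Out a), Tau}\<rbrakk>
        \<Longrightarrow> \<exists>q. step p' \<alpha> q \<and> step p'' (Vis (Out a)) q"
    and backward_output_determinacy:
      "\<lbrakk>step p' (Vis (Out a)) p; step p'' (Vis (Out a)) p\<rbrakk> \<Longrightarrow> p' = p''"

text \<open>Must-testing observes infinite traces, the must-set preorder only finite ones; Koenig's
  lemma bridges the gap for image-finite systems.\<close>

definition image_finite :: "('s, 'n) trans \<Rightarrow> bool" where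
  "image_finite step \<longleftrightarrow> (\<forall>p \<alpha>. finite {p'. step p \<alpha> p'})"

inductive weak :: "('s, 'n) trans \<Rightarrow> 's \<Rightarrow> 'n act list \<Rightarrow> 's \<Rightarrow> bool"
  for step :: "('s, 'n) trans" where
  weak_refl: "weak step p [] p"
| weak_tau: "\<lbrakk>step p Tau p''; weak step p'' s p'\<rbrakk> \<Longrightarrow> weak step p s p'"
| weak_act: "\<lbrakk>step p (Vis \<mu>) p''; weak step p'' s p'\<rbrakk> \<Longrightarrow> weak step p (\<mu> # s) p'"

definition converges :: "('s, 'n) trans \<Rightarrow> 's \<Rightarrow> bool" where
  "converges step p \<longleftrightarrow> \<not> (\<exists>f :: nat \<Rightarrow> 's. f 0 = p \<and> (\<forall>i. step (f i) Tau (f (Suc i))))"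

inductive converges_along :: "('s, 'n) trans \<Rightarrow> 's \<Rightarrow> 'n act list \<Rightarrow> bool"
  for step :: "('s, 'n) trans" where
  converges_along_Nil: "converges step p \<Longrightarrow> converges_along step p []"
| converges_along_Cons:
    "\<lbrakk>converges step p; \<And>p'. weak step p [\<mu>] p' \<Longrightarrow> converges_along step p' s\<rbrakk>
      \<Longrightarrow> converges_along step p (\<mu> # s)"

inductive reduces :: "('s, 'n) trans \<Rightarrow> ('c, 'n) trans \<Rightarrow> 's \<times> 'c \<Rightarrow> 's \<times> 'c \<Rightarrow> bool"
  for step :: "('s, 'n) trans" and stepC :: "('c, 'n) trans" where
  server_tau: "step p Tau p' \<Longrightarrow> reduces step stepC (p, r) (p', r)"
| client_tau: "stepC r Tau r' \<Longrightarrow> reduces step stepC (p, r) (p, r')"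
| communication:
    "\<lbrakk>step p (Vis \<mu>) p'; stepC r (Vis (co \<mu>)) r'\<rbrakk> \<Longrightarrow> reduces step stepC (p, r) (p', r')"

text \<open>The last axiom says that the pending outputs of a client form a finite multiset, not
  merely a finite set of labels: a client that can emit the same message forever must be
  excluded, because a server may consume that stream without bound where its forwarder
  specification only stores it, and the must-set preorder does not see the difference.\<close>

locale client = Fdb step for step :: "('c, 'n) trans" +
  fixes good :: "'c \<Rightarrow> bool"
  assumes good_output: "step r (Vis (Out a)) r' \<Longrightarrow> good r \<longleftrightarrow> good r'"
    and outputs_terminate:
      "\<not> (\<exists>f :: nat \<Rightarrow> 'c. \<forall>i. \<exists>a. step (f i) (Vis (Out a)) (f (Suc i)))"

text \<open>The two conjuncts treat the infinite and the finite maximal computations.\<close>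

definition must ::
  "('s, 'n) trans \<Rightarrow> ('c, 'n) trans \<Rightarrow> ('c \<Rightarrow> bool) \<Rightarrow> 's \<Rightarrow> 'c \<Rightarrow> bool" where
  "must step stepC good p r \<longleftrightarrow>
    (\<forall>f. f 0 = (p, r) \<and> (\<forall>i. reduces step stepC (f i) (f (Suc i)))
      \<longrightarrow> (\<exists>i. good (snd (f i)))) \<and>
    (\<forall>f n. f 0 = (p, r) \<and> (\<forall>i<n. reduces step stepC (f i) (f (Suc i))) \<and>
        \<not> (\<exists>x. reduces step stepC (f n) x)
      \<longrightarrow> (\<exists>i\<le>n. good (snd (f i))))"

text \<open>HOL cannot quantify over types inside a formula, so the type of client states is a
  parameter, to be generalised at theorem level.\<close>

definition must_preorder ::
  "'c itself \<Rightarrow> ('a, 'n) trans \<Rightarrow> ('b, 'n) trans \<Rightarrow> 'a \<Rightarrow> 'b \<Rightarrow> bool" where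
  "must_preorder (_ :: 'c itself) stepA stepB p q \<longleftrightarrow>
    (\<forall>(stepC :: ('c, 'n) trans) good r. client stepC good \<longrightarrow>
      must stepA stepC good p r \<longrightarrow> must stepB stepC good q r)"

text \<open>A multiset of co-names is represented by the multiset of the underlying names.\<close>

datatype ('s, 'n) fw_state = Fw 's "'n multiset" (infix "\<triangleright>" 60)

inductive fw_step :: "('s, 'n) trans \<Rightarrow> (('s, 'n) fw_state, 'n) trans"
  for step :: "('s, 'n) trans" where
  fw_lift: "step p \<alpha> p' \<Longrightarrow> fw_step step (p \<triangleright> M) \<alpha> (p' \<triangleright> M)"
| fw_comm: "step p (Vis (In a)) p' \<Longrightarrow> fw_step step (p \<triangleright> add_mset a M) Tau (p' \<triangleright> M)"
| fw_out: "fw_step step (p \<triangleright> add_mset a M) (Vis (Out a)) (p \<triangleright> M)"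
| fw_in: "fw_step step (p \<triangleright> M) (Vis (In a)) (p \<triangleright> add_mset a M)"

definition must_set :: "('s, 'n) trans \<Rightarrow> 's \<Rightarrow> 'n act set \<Rightarrow> bool" where
  "must_set step p X \<longleftrightarrow>
    (\<forall>p'. weak step p [] p' \<longrightarrow> (\<exists>\<mu>\<in>X. \<exists>p''. weak step p' [\<mu>] p''))"

definition after :: "('s, 'n) trans \<Rightarrow> 's \<Rightarrow> 'n act list \<Rightarrow> 's set" where
  "after step p s = {p'. weak step p s p'}"

definition cnv_preorder :: "('a, 'n) trans \<Rightarrow> ('b, 'n) trans \<Rightarrow> 'a \<Rightarrow> 'b \<Rightarrow> bool" where
  "cnv_preorder stepA stepB p q \<longleftrightarrow>
    (\<forall>s. converges_along stepA p s \<longrightarrow> converges_along stepB q s)"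

definition M_preorder :: "('a, 'n) trans \<Rightarrow> ('b, 'n) trans \<Rightarrow> 'a \<Rightarrow> 'b \<Rightarrow> bool" where
  "M_preorder stepA stepB p q \<longleftrightarrow>
    (\<forall>s X. converges_along stepA p s \<longrightarrow> finite X \<longrightarrow>
      (\<forall>p'\<in>after stepA p s. must_set stepA p' X) \<longrightarrow>
      (\<forall>q'\<in>after stepB q s. must_set stepB q' X))"

definition MS_preorder :: "('a, 'n) trans \<Rightarrow> ('b, 'n) trans \<Rightarrow> 'a \<Rightarrow> 'b \<Rightarrow> bool" where
  "MS_preorder stepA stepB p q \<longleftrightarrow>
    cnv_preorder stepA stepB p q \<and> M_preorder stepA stepB p q"

end

theory Submission
  imports Defs
begin

text \<open>Since the outputs of a client commute with all its transitions, feed back into its inputs and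
  terminate, a message pending at the client may equally well be stored in the buffer of a
  forwarding server; hence a server passes the same tests as its forwarding lifting, and the
  lifting can be analysed instead.

  Soundness: consider an unsuccessful maximal computation of the better server. If it ends in a
  deadlock or in divergence, the trace exchanged up to there is copied by the worse server by
  the must-set preorder; if the client moves forever, every finite prefix of the infinite trace
  is copied (must-sets for the empty set), and Koenig's lemma yields an infinite copy.

  Completeness: a trace and a must-set are both observed by one asynchronous client that emits
  the inputs of the trace from a buffer and gives up successfully instead of waiting for an
  output; on a forwarder its pending messages may be delivered in the order of the trace.\<close>

section \<open>Weak transitions and convergence\<close>

lemma weak_single: "step p (Vis \<mu>) p' \<Longrightarrow> weak step p [\<mu>] p'"
  by (auto intro: weak.intros)

lemma weak_append:
  assumes "weak step p s p'" "weak step p' t p''"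
  shows "weak step p (s @ t) p''"
  using assms by (induction rule: weak.induct) (auto intro: weak.intros)

lemma weak_split:
  assumes "weak step p (s @ t) p''"
  shows "\<exists>p'. weak step p s p' \<and> weak step p' t p''"
  using assms
proof (induction p "s @ t" p'' arbitrary: s rule: weak.induct)
  case (weak_refl p)
  then show ?case by (auto intro: weak.intros)
next
  case (weak_tau p p'' p')
  then show ?case by (blast intro: weak.intros)
next
  case (weak_act p \<mu> p'' u p')
  show ?case
  proof (cases s)
    case Nil
    then have "weak step p [] p" "weak step p t p'"
      using weak_act by (auto intro: weak.intros)
    with Nil show ?thesis by blast
  next
    case (Cons \<nu> s')
    then show ?thesis
      using weak_act by (metis append_Cons list.inject weak.weak_act)
  qed
qed

lemma converges_tau:
  assumes "converges step p" "step p Tau p'"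
  shows "converges step p'"
proof (rule ccontr)
  assume "\<not> converges step p'"
  then obtain f where f: "f 0 = p'" "\<And>i. step (f i) Tau (f (Suc i))"
    by (auto simp: converges_def)
  have "\<not> converges step p"
    unfolding converges_def not_not
    by (rule exI[of _ "case_nat p f"]) (use f assms(2) in \<open>auto split: nat.split\<close>)
  then show False using assms(1) by contradiction
qed

text \<open>If the conclusion failed at \<open>p\<close>, dependent choice would extend the failure
  to an infinite sequence of silent moves.\<close>

lemma converges_induct [consumes 1, case_names tau]:
  assumes "converges step p"
    and step: "\<And>p. converges step p \<Longrightarrow> (\<And>p'. step p Tau p' \<Longrightarrow> P p') \<Longrightarrow> P p"
  shows "P p"
proof (rule ccontr)
  assume "\<not> P p"
  let ?Q = "\<lambda>p. converges step p \<and> \<not> P p"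
  have "\<exists>p'. ?Q p' \<and> step p Tau p'" if "?Q p" for p
  proof (rule ccontr)
    assume none: "\<not> ?thesis"
    have "P p" by (rule step) (use none that converges_tau[of step p] in auto)
    then show False using that by simp
  qed
  moreover have "?Q p" using \<open>\<not> P p\<close> assms(1) by blast
  ultimately have "\<exists>f. \<forall>i. ?Q (f i) \<and> step (f i) Tau (f (Suc i))"
    by (intro dependent_nat_choice) auto
  then obtain f where f: "\<forall>i. ?Q (f i) \<and> step (f i) Tau (f (Suc i))" by (rule exE)
  have "\<not> converges step (f 0)" unfolding converges_def not_not by (rule exI[of _ f]) (simp add: f)
  then show False using f by blast
qed

lemma not_converges_tau_ex:
  assumes "\<not> converges step p"
  shows "\<exists>p'. step p Tau p' \<and> \<not> converges step p'"
proof -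
  obtain f where f: "f 0 = p" "\<And>i. step (f i) Tau (f (Suc i))"
    using assms by (auto simp: converges_def)
  have "\<not> converges step (f (Suc 0))"
    unfolding converges_def not_not by (rule exI[of _ "\<lambda>i. f (Suc i)"]) (simp add: f)
  then show ?thesis using f by metis
qed

lemma converges_weak_Nil:
  fixes step :: "('s, 'n) trans"
  assumes "weak step p [] p'" "converges step p"
  shows "converges step p'"
  using assms by (induction p "[] :: 'n act list" p' rule: weak.induct) (auto intro: converges_tau)

lemma converges_reaches_stable:
  assumes "converges step p"
  shows "\<exists>p'. weak step p [] p' \<and> (\<forall>p''. \<not> step p' Tau p'')"
  using assms by (induction rule: converges_induct) (metis weak.intros(1,2))

lemma converges_along_imp_converges: "converges_along step p s \<Longrightarrow> converges step p"
  by (auto elim: converges_along.cases)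

lemma converges_along_Cons_iff:
  "converges_along step p (\<mu> # s) \<longleftrightarrow>
    converges step p \<and> (\<forall>p'. weak step p [\<mu>] p' \<longrightarrow> converges_along step p' s)"
  by (subst converges_along.simps) auto

lemma converges_along_Nil_iff: "converges_along step p [] \<longleftrightarrow> converges step p"
  by (subst converges_along.simps) auto

lemma converges_along_weak_Nil:
  assumes "converges_along step p s" "weak step p [] p'"
  shows "converges_along step p' s"
proof (cases s)
  case Nil
  then show ?thesis using assms converges_weak_Nil by (auto simp: converges_along_Nil_iff)
next
  case (Cons \<mu> u)
  then show ?thesis
    using assms converges_weak_Nil weak_append[of step p "[]" p' "[\<mu>]"]
    by (auto simp: converges_along_Cons_iff)
qed

lemma converges_along_append:
  assumes "converges_along step p (s @ t)" "weak step p s p'"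
  shows "converges_along step p' t"
  using assms
proof (induction s arbitrary: p rule: list.induct)
  case Nil
  then show ?case by (auto intro: converges_along_weak_Nil)
next
  case (Cons \<mu> s)
  then obtain p1 where "weak step p [\<mu>] p1" "weak step p1 s p'"
    using weak_split[of step p "[\<mu>]" s p'] by auto
  then show ?case using Cons by (auto simp: converges_along_Cons_iff)
qed

section \<open>Finiteness of weak derivatives\<close>

lemma finite_weak_Nil:
  assumes "image_finite step" "converges step p"
  shows "finite {p'. weak step p [] p'}"
  using assms(2)
proof (induction rule: converges_induct)
  case (tau p)
  have "{p'. weak step p [] p'} = insert p (\<Union>p1\<in>{p1. step p Tau p1}. {p'. weak step p1 [] p'})"
    by (auto intro: weak.intros elim: weak.cases)
  moreover have "finite {p1. step p Tau p1}" using assms(1) by (auto simp: image_finite_def)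
  ultimately show ?case using tau by auto
qed

lemma weak_single_decompose:
  assumes "weak step p [\<mu>] p'"
  shows "\<exists>p1 p2. weak step p [] p1 \<and> step p1 (Vis \<mu>) p2 \<and> weak step p2 [] p'"
  using assms by (induction p "[\<mu>]" p' rule: weak.induct) (auto intro: weak.intros)

text \<open>Convergence makes each stretch of silent moves a finite tree, and image-finiteness
  bounds the visible moves between two stretches.\<close>

lemma finite_weak:
  assumes fin: "image_finite step" and "converges_along step p s"
  shows "finite {p'. weak step p s p'}"
  using assms(2)
proof (induction s arbitrary: p rule: list.induct)
  case Nil
  then show ?case using finite_weak_Nil[OF fin] by (simp add: converges_along_Nil_iff)
next
  case (Cons \<mu> s)
  \<comment> \<open>Silent moves after the action are left out of \<open>?N\<close>; the weak
    transition along \<open>s\<close> absorbs them.\<close>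
  let ?N = "\<Union>p1\<in>{p1. weak step p [] p1}. {p2. step p1 (Vis \<mu>) p2}"
  have conv: "converges_along step p2 s" if "p2 \<in> ?N" for p2
  proof -
    from that obtain p1 where "weak step p [] p1" "step p1 (Vis \<mu>) p2" by blast
    then have "weak step p [\<mu>] p2"
      using weak_append[of step p "[]" p1 "[\<mu>]" p2] by (auto intro: weak.intros)
    then show ?thesis using Cons.prems by (simp add: converges_along_Cons_iff)
  qed
  have "{p'. weak step p (\<mu> # s) p'} \<subseteq> (\<Union>p2\<in>?N. {p'. weak step p2 s p'})"
  proof
    fix p' assume "p' \<in> {p'. weak step p (\<mu> # s) p'}"
    then obtain p1 where "weak step p [\<mu>] p1" "weak step p1 s p'"
      using weak_split[of step p "[\<mu>]" s p'] by auto
    with weak_single_decompose[of step p \<mu> p1]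
    show "p' \<in> (\<Union>p2\<in>?N. {p'. weak step p2 s p'})"
      using weak_append[of step _ "[]" p1 s p'] by fastforce
  qed
  moreover have "finite ?N"
    using finite_weak_Nil[OF fin converges_along_imp_converges[OF Cons.prems]] fin
    by (auto simp: image_finite_def)
  ultimately show ?case
    using conv Cons.IH by (meson finite_UN_I finite_subset)
qed

section \<open>Unsuccessful maximal computations\<close>

text \<open>The greatest fixed point covers finite and infinite unsuccessful maximal computations at
  once, so that they can be transformed move by move by coinduction.\<close>

coinductive doomed ::
  "('s, 'n) trans \<Rightarrow> ('c, 'n) trans \<Rightarrow> ('c \<Rightarrow> bool) \<Rightarrow> 's \<Rightarrow> 'c \<Rightarrow> bool"
  for step :: "('s, 'n) trans" and stepC :: "('c, 'n) trans" and good :: "'c \<Rightarrow> bool" where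
  doomed_stuck:
    "\<lbrakk>\<not> good r; \<And>x. \<not> reduces step stepC (p, r) x\<rbrakk> \<Longrightarrow> doomed step stepC good p r"
| doomed_step:
    "\<lbrakk>\<not> good r; reduces step stepC (p, r) (p', r'); doomed step stepC good p' r'\<rbrakk>
      \<Longrightarrow> doomed step stepC good p r"

lemma doomed_not_good: "doomed step stepC good p r \<Longrightarrow> \<not> good r"
  by (erule doomed.cases) auto

lemma not_doomedI:
  assumes "reduces step stepC (p, r) x"
    and "\<And>p' r'. reduces step stepC (p, r) (p', r') \<Longrightarrow> \<not> doomed step stepC good p' r'"
  shows "\<not> doomed step stepC good p r"
proof
  assume "doomed step stepC good p r"
  then show False by cases (use assms in blast)+
qed

lemma doomed_infinite:
  assumes "f 0 = (p, r)" "\<And>i. reduces step stepC (f i) (f (Suc i))" "\<And>i. \<not> good (snd (f i))"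
  shows "doomed step stepC good p r"
proof -
  have "\<exists>i. f i = (p, r)" using assms(1) by blast
  then show ?thesis
  proof (coinduction arbitrary: p r)
    case doomed
    then obtain i where "f i = (p, r)" by blast
    moreover obtain p' r' where "f (Suc i) = (p', r')" by (cases "f (Suc i)")
    ultimately have "\<not> good r" "reduces step stepC (p, r) (p', r')" "\<exists>i. f i = (p', r')"
      using assms(2)[of i] assms(3)[of i] by (simp_all add: exI[of _ "Suc i"])
    then show ?case by blast
  qed
qed

lemma doomed_finite:
  assumes "f 0 = (p, r)" "\<And>i. i < n \<Longrightarrow> reduces step stepC (f i) (f (Suc i))"
    "\<And>x. \<not> reduces step stepC (f n) x" "\<And>i. i \<le> n \<Longrightarrow> \<not> good (snd (f i))"
  shows "doomed step stepC good p r"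
proof -
  have "doomed step stepC good (fst (f i)) (snd (f i))" if "i \<le> n" for i
    using that
  proof (induction rule: inc_induct)
    case base
    show ?case by (rule doomed_stuck) (use assms(3,4) in simp_all)
  next
    case (step i)
    show ?case
      by (rule doomed_step[where p' = "fst (f (Suc i))" and r' = "snd (f (Suc i))"])
        (use step assms(2)[of i] assms(4)[of i] in simp_all)
  qed
  from this[of 0] show ?thesis using assms(1) by simp
qed

text \<open>A doomed pair is unfolded by choosing doomed successors; the resulting computation is
  infinite or ends at its first stuck pair. Conversely, doom is read off an unsuccessful
  computation, by coinduction if it is infinite and by backward induction if it is finite.\<close>

lemma must_iff_not_doomed: "must step stepC good p r \<longleftrightarrow> \<not> doomed step stepC good p r"
proof
  assume must: "must step stepC good p r"
  show "\<not> doomed step stepC good p r"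
  proof
    assume doom: "doomed step stepC good p r"
    let ?R = "reduces step stepC" and ?D = "\<lambda>x. doomed step stepC good (fst x) (snd x)"
    have ex: "\<exists>y. ?R x y \<and> ?D y" if "?R x y" "?D x" for x y
      using that(2)
    proof cases
      case (doomed_step p' r')
      then show ?thesis by (intro exI[of _ "(p', r')"]) simp
    qed (use that(1) in simp)
    \<comment> \<open>The value \<open>x\<close> at a stuck pair makes the sequence \<open>f\<close>
      below constant from there on, so that it is doomed at every index.\<close>
    define next_state where "next_state x = (if \<exists>y. ?R x y then SOME y. ?R x y \<and> ?D y else x)" for x
    have next_state: "?R x (next_state x) \<and> ?D (next_state x)" if "?R x y" "?D x" for x y
    proof -
      have "next_state x = (SOME y. ?R x y \<and> ?D y)" using that(1) unfolding next_state_def by (intro if_P exI)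
      then show ?thesis using someI_ex[OF ex[OF that]] by simp
    qed
    define f where "f = rec_nat (p, r) (\<lambda>_. next_state)"
    have f0: "f 0 = (p, r)" and f_Suc: "f (Suc i) = next_state (f i)" for i
      by (simp_all add: f_def)
    have fS: "?R (f i) (f (Suc i)) \<and> ?D (f (Suc i))" if "?R (f i) y" "?D (f i)" for i y
      using next_state[OF that] by (simp add: f_Suc)
    have D: "?D (f i)" for i
    proof (induction i)
      case (Suc i)
      show ?case
      proof (cases "\<exists>y. ?R (f i) y")
        case True
        then show ?thesis using fS Suc by auto
      next
        case False
        then have "f (Suc i) = f i" by (simp add: f_Suc next_state_def)
        then show ?thesis using Suc by simp
      qed
    qed (simp add: f0 doom)
    then have bad: "\<not> good (snd (f i))" for i
      by (rule doomed_not_good)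
    show False
    proof (cases "\<forall>i. \<exists>y. ?R (f i) y")
      case True
      then have "\<forall>i. ?R (f i) (f (Suc i))" using fS D by auto
      then show False
        using must[unfolded must_def, THEN conjunct1, rule_format, of f] f0 bad by auto
    next
      case False
      define n where "n = (LEAST n. \<not> (\<exists>y. ?R (f n) y))"
      have "\<not> (\<exists>y. ?R (f n) y)"
        unfolding n_def by (rule LeastI_ex) (use False in blast)
      moreover have "?R (f i) (f (Suc i))" if "i < n" for i
        using not_less_Least[OF that[unfolded n_def]] fS D by auto
      ultimately show False
        using must[unfolded must_def, THEN conjunct2, rule_format, of f n] f0 bad by auto
    qed
  qed
next
  assume "\<not> doomed step stepC good p r"
  then show "must step stepC good p r"
  proof (rule contrapos_np)
    assume "\<not> must step stepC good p r"
    then consider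
      "\<exists>f. f 0 = (p, r) \<and> (\<forall>i. reduces step stepC (f i) (f (Suc i))) \<and> (\<forall>i. \<not> good (snd (f i)))"
    | "\<exists>f n. f 0 = (p, r) \<and> (\<forall>i<n. reduces step stepC (f i) (f (Suc i))) \<and>
        (\<forall>x. \<not> reduces step stepC (f n) x) \<and> (\<forall>i\<le>n. \<not> good (snd (f i)))"
      unfolding must_def by auto
    then show "doomed step stepC good p r"
    proof cases
      case 1
      then show ?thesis using doomed_infinite by metis
    next
      case 2
      then show ?thesis using doomed_finite by metis
    qed
  qed
qed

lemma doomed_divergent:
  assumes "\<not> converges step p" "\<not> good r"
  shows "doomed step stepC good p r"
  using assms
proof (coinduction arbitrary: p)
  case doomed
  then obtain p' where "step p Tau p'" "\<not> converges step p'"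
    using not_converges_tau_ex by metis
  then show ?case using doomed server_tau[of step p p' stepC r] by auto
qed

lemma doomed_weak_Nil:
  fixes step :: "('s, 'n) trans"
  assumes "weak step p [] p'" "doomed step stepC good p' r"
  shows "doomed step stepC good p r"
  using assms
  by (induction p "[] :: 'n act list" p' rule: weak.induct) (auto intro: doomed_step server_tau dest: doomed_not_good)

section \<open>Runs of a client\<close>

lemma co_co [simp]: "co (co \<mu>) = \<mu>"
  by (cases \<mu>) auto

text \<open>Labels of the client are recorded from the side of the server, so that the trace of a
  client run can directly index \<open>weak\<close> for the server.\<close>

fun co_trace :: "'n label \<Rightarrow> 'n act list" where
  "co_trace Tau = []"
| "co_trace (Vis \<mu>) = [co \<mu>]"

inductive client_run ::
  "('c, 'n) trans \<Rightarrow> ('c \<Rightarrow> bool) \<Rightarrow> 'c \<Rightarrow> 'n act list \<Rightarrow> 'c \<Rightarrow> bool"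
  for stepC :: "('c, 'n) trans" and good :: "'c \<Rightarrow> bool" where
  client_run_Nil: "\<not> good r \<Longrightarrow> client_run stepC good r [] r"
| client_run_step:
    "\<lbrakk>stepC r l r1; \<not> good r; client_run stepC good r1 s r'\<rbrakk>
      \<Longrightarrow> client_run stepC good r (co_trace l @ s) r'"

lemma client_run_not_good:
  assumes "client_run stepC good r s r'"
  shows "\<not> good r'"
  using assms by (induction rule: client_run.induct)

text \<open>Silent moves of the server before its answer to \<open>l\<close> become moves of the
  pair while the client waits in the unsuccessful state \<open>r\<close>; those after the answer
  happen while the client is in \<open>r'\<close>.\<close>

lemma doomed_client_step:
  assumes "weak step p (co_trace l) p'" "stepC r l r'" "\<not> good r" "doomed step stepC good p' r'"
  shows "doomed step stepC good p r"
  using assms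
proof (induction p "co_trace l" p' rule: weak.induct)
  case (weak_refl p)
  then show ?case by (cases l) (auto intro: doomed_step client_tau)
next
  case (weak_tau p p'' p')
  then show ?case by (blast intro: doomed_step server_tau)
next
  case (weak_act p \<mu> p'' s p')
  then have l: "l = Vis (co \<mu>)" "s = []" by (cases l; auto)+
  then have "doomed step stepC good p'' r'"
    using weak_act doomed_weak_Nil[of step p'' p' stepC good r'] by simp
  then show ?case using weak_act l by (blast intro: doomed_step communication)
qed

lemma doomed_client_run:
  assumes "client_run stepC good r s r'" "weak step p s p'" "doomed step stepC good p' r'"
  shows "doomed step stepC good p r"
  using assms
proof (induction arbitrary: p rule: client_run.induct)
  case (client_run_Nil r)
  then show ?case using doomed_weak_Nil[of step p p' stepC good r] by simp
next
  case (client_run_step r l r1 s r')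
  then show ?case using weak_split doomed_client_step by metis
qed

text \<open>The client follows its run until the server reaches a divergent state, and then waits
  there forever.\<close>

lemma doomed_not_converges_along:
  assumes "client_run stepC good r s r'" "\<not> converges_along step p s"
  shows "doomed step stepC good p r"
  using assms
proof (induction arbitrary: p rule: client_run.induct)
  case (client_run_Nil r)
  then show ?case by (auto simp: converges_along_Nil_iff intro: doomed_divergent)
next
  case (client_run_step r l r1 s r')
  show ?case
  proof (cases "converges step p")
    case True
    then obtain p' where "weak step p (co_trace l) p'" "\<not> converges_along step p' s"
      using client_run_step.prems
      by (cases l) (auto simp: converges_along_Cons_iff intro: weak_refl)
    then show ?thesis using client_run_step doomed_client_step by metis
  qed (simp add: client_run_step doomed_divergent)
qed

section \<open>Moving messages between the buffers of client and server\<close>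

text \<open>In use, \<open>r\<close> is a client, \<open>M\<close> the part of its outputs stored by
  the forwarding server, and \<open>r'\<close> what remains of the client.\<close>

inductive emits :: "('s, 'n) trans \<Rightarrow> 's \<Rightarrow> 'n multiset \<Rightarrow> 's \<Rightarrow> bool"
  for step :: "('s, 'n) trans" where
  emits_empty: "emits step r {#} r"
| emits_add: "\<lbrakk>step r (Vis (Out a)) r1; emits step r1 M r'\<rbrakk> \<Longrightarrow> emits step r (add_mset a M) r'"

lemma emits_snoc:
  assumes "emits step r M r1" "step r1 (Vis (Out a)) r'"
  shows "emits step r (add_mset a M) r'"
  using assms
proof (induction rule: emits.induct)
  case (emits_add r b r2 M r1)
  then have "emits step r (add_mset b (add_mset a M)) r'" by (blast intro: emits.intros)
  then show ?case by (simp add: add_mset_commute)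
qed (auto intro: emits.intros)

context Fdb
begin

lemma emits_commute:
  assumes "emits step r M r1" "step r1 \<alpha> r'"
  shows "\<exists>r2. step r \<alpha> r2 \<and> emits step r2 M r'"
  using assms
proof (induction rule: emits.induct)
  case (emits_add r a r1 M r2)
  then obtain r3 where r3: "step r1 \<alpha> r3" "emits step r3 M r'" by blast
  from output_commutativity[OF emits_add.hyps(1) r3(1)] r3(2) show ?case
    using emits.emits_add by metis
qed (auto intro: emits.intros)

text \<open>Output-commutativity moves the emission of \<open>a\<close> before all earlier
  ones.\<close>

lemma emits_extract:
  assumes "emits step r M r'" "a \<in># M"
  shows "\<exists>r1. step r (Vis (Out a)) r1 \<and> emits step r1 (M - {#a#}) r'"
  using assms
proof (induction rule: emits.induct)
  case (emits_add r b r1 M r')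
  show ?case
  proof (cases "a = b")
    case False
    then have "a \<in># M" using emits_add by auto
    then obtain r2 where r2: "step r1 (Vis (Out a)) r2" "emits step r2 (M - {#a#}) r'"
      using emits_add.IH by blast
    obtain r3 where r3: "step r (Vis (Out a)) r3" "step r3 (Vis (Out b)) r2"
      using output_commutativity[OF emits_add.hyps(1) r2(1)] by blast
    have "emits step r3 (add_mset b (M - {#a#})) r'" using r3 r2 by (blast intro: emits.intros)
    moreover have "add_mset b M - {#a#} = add_mset b (M - {#a#})" using False by simp
    ultimately show ?thesis using r3(1) by metis
  qed (use emits_add in auto)
qed simp

text \<open>The emission of \<open>a\<close> and its reception can both be brought to the front,
  before the emission of \<open>M\<close>; being adjacent, they feed back.\<close>

lemma emits_feedback:
  assumes "emits step r (add_mset a M) r1" "step r1 (Vis (In a)) r'"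
  shows "\<exists>r2. step r Tau r2 \<and> emits step r2 M r'"
  using emits_extract[OF assms(1), of a] emits_commute[OF _ assms(2)] feedback by fastforce

lemma emits_determinacy:
  assumes "emits step r M r1" "step r (Vis (Out a)) r'" "a \<in># M"
  shows "emits step r' (M - {#a#}) r1"
  using emits_extract[OF assms(1,3)] output_determinacy assms(2) by blast

lemma emits_confluence:
  assumes "emits step r M r1" "step r (Vis \<mu>) r'" "\<And>a. a \<in># M \<Longrightarrow> \<mu> \<noteq> Out a"
  shows "\<exists>r2. step r1 (Vis \<mu>) r2 \<and> emits step r' M r2"
  using assms
proof (induction arbitrary: r' rule: emits.induct)
  case (emits_add r b r1 M r'')
  then obtain r2 where "step r1 (Vis \<mu>) r2" "step r' (Vis (Out b)) r2"
    using output_confluence[of r b r1 "Vis \<mu>" r'] by auto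
  then show ?case using emits_add.IH[of r2] emits_add.prems by (auto intro: emits.intros)
qed (auto intro: emits.intros)

text \<open>Output-tau is iterated over \<open>M\<close>: the silent move survives all emissions, or
  else, the first time it does not, it is a reception of the message just emitted, and this
  reception survives the remaining emissions by confluence.\<close>

lemma emits_tau:
  assumes "emits step r M r1" "step r Tau r'"
  shows "(\<exists>r2. step r1 Tau r2 \<and> emits step r' M r2) \<or>
    (\<exists>a r2. a \<in># M \<and> step r1 (Vis (In a)) r2 \<and> emits step r' (M - {#a#}) r2)"
  using assms
proof (induction arbitrary: r' rule: emits.induct)
  case (emits_add r b r1 M r'')
  from output_tau[OF emits_add.hyps(1) emits_add.prems] show ?case
  proof
    assume "\<exists>q. step r1 Tau q \<and> step r' (Vis (Out b)) q"
    then obtain q where q: "step r1 Tau q" "step r' (Vis (Out b)) q" by blast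
    from emits_add.IH[OF q(1)] show ?case
    proof (elim disjE exE conjE)
      fix r2 assume "step r'' Tau r2" "emits step q M r2"
      then show ?thesis using q(2) by (blast intro: emits.intros)
    next
      fix a r2 assume a: "a \<in># M" "step r'' (Vis (In a)) r2" "emits step q (M - {#a#}) r2"
      then have "emits step r' (add_mset b (M - {#a#})) r2" using q(2) by (blast intro: emits.intros)
      then have "emits step r' (add_mset b M - {#a#}) r2" using a(1) by simp
      moreover have "a \<in># add_mset b M" using a(1) by simp
      ultimately show ?thesis using a(2) by blast
    qed
  next
    assume "step r1 (Vis (In b)) r'"
    then obtain r2 where "step r'' (Vis (In b)) r2" "emits step r' M r2"
      using emits_confluence[OF emits_add.hyps(2)] by blast
    then show ?case by force
  qed
qed (auto intro: emits.intros)

end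

section \<open>Clients facing a server with or without a buffer\<close>

context client
begin

lemma emits_good:
  assumes "emits step r M r'"
  shows "good r \<longleftrightarrow> good r'"
  using assms by (induction rule: emits.induct) (auto dest: good_output)

text \<open>Termination of outputs, turned into an induction principle by dependent choice.\<close>

lemma output_induct [case_names emit]:
  assumes "\<And>r. (\<And>a r'. step r (Vis (Out a)) r' \<Longrightarrow> P r') \<Longrightarrow> P r"
  shows "P r"
proof (rule ccontr)
  assume "\<not> P r"
  have "\<exists>r'. \<not> P r' \<and> (\<exists>a. step r (Vis (Out a)) r')" if "\<not> P r" for r
    using assms[of r] that by blast
  then have "\<exists>f. \<forall>i. \<not> P (f i) \<and> (\<exists>a. step (f i) (Vis (Out a)) (f (Suc i)))"
    using \<open>\<not> P r\<close> by (intro dependent_nat_choice) auto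
  then obtain f where "\<forall>i. \<not> P (f i) \<and> (\<exists>a. step (f i) (Vis (Out a)) (f (Suc i)))" by (rule exE)
  then have "\<forall>i. \<exists>a. step (f i) (Vis (Out a)) (f (Suc i))" by simp
  then show False using outputs_terminate by (metis (no_types))
qed

text \<open>Every move of the pair without buffer is matched by exactly one move of the pair with
  buffer; a stuck pair is matched by flushing the remaining outputs of the client.\<close>

lemma reduces_into_buffer:
  assumes M: "emits step r M r'" and red: "reduces stepS step (p, r) (p1, r1)"
  shows "\<exists>M1 r1'. emits step r1 M1 r1' \<and>
    reduces (fw_step stepS) step (p \<triangleright> M, r') (p1 \<triangleright> M1, r1')"
  using red
proof cases
  case server_tau
  then show ?thesis using M by (blast intro: reduces.server_tau fw_lift)
next
  case client_tau
  from emits_tau[OF M client_tau(2)] show ?thesis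
  proof (elim disjE exE conjE)
    fix r2 assume "step r' Tau r2" "emits step r1 M r2"
    then show ?thesis using client_tau by (blast intro: reduces.client_tau)
  next
    fix a r2 assume a: "a \<in># M" "step r' (Vis (In a)) r2" "emits step r1 (M - {#a#}) r2"
    have "fw_step stepS (p \<triangleright> M) (Vis (Out a)) (p \<triangleright> (M - {#a#}))"
      using fw_out[of stepS p a "M - {#a#}"] a(1) by simp
    then have "reduces (fw_step stepS) step (p \<triangleright> M, r') (p \<triangleright> (M - {#a#}), r2)"
      using reduces.communication[of "fw_step stepS" _ "Out a"] a(2) by simp
    then show ?thesis using a(3) client_tau by blast
  qed
next
  case (communication \<mu>)
  show ?thesis
  proof (cases "\<exists>a. a \<in># M \<and> co \<mu> = Out a")
    \<comment> \<open>The message sent by the client already lies in the buffer of the server, which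
      consumes it silently while \<open>r'\<close> stays put.\<close>
    case True
    then obtain a where a: "a \<in># M" "\<mu> = In a" "co \<mu> = Out a" by (cases \<mu>) auto
    have "emits step r1 (M - {#a#}) r'"
      using emits_determinacy[OF M] communication(2) a by simp
    moreover have "fw_step stepS (p \<triangleright> M) Tau (p1 \<triangleright> (M - {#a#}))"
      using fw_comm[of stepS p a p1 "M - {#a#}"] communication(1) a by simp
    ultimately show ?thesis by (blast intro: reduces.server_tau)
  next
    case False
    then obtain r2 where "step r' (Vis (co \<mu>)) r2" "emits step r1 M r2"
      using emits_confluence[OF M communication(2)] by blast
    then show ?thesis using communication(1) by (blast intro: reduces.communication fw_lift)
  qed
qed

text \<open>Any move of the buffered pair other than a flush could be pulled back across the
  emissions in \<open>M\<close> to a move of the unbuffered pair.\<close>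

lemma stuck_into_buffer:
  assumes M: "emits step r M r'" and stuck: "\<And>x. \<not> reduces stepS step (p, r) x"
    and red: "reduces (fw_step stepS) step (p \<triangleright> M, r') (P, r1)"
  shows "\<exists>a. P = p \<triangleright> add_mset a M \<and> step r' (Vis (Out a)) r1"
  using red
proof cases
  case server_tau
  from server_tau(2) show ?thesis
  proof cases
    case (fw_lift p')
    then show ?thesis using stuck reduces.server_tau by metis
  next
    case (fw_comm a p' N)
    then obtain r2 where "step r (Vis (Out a)) r2" using emits_extract[OF M, of a] by auto
    then show ?thesis using fw_comm stuck reduces.communication[of stepS p "In a"] by (metis co.simps(1))
  qed
next
  case client_tau
  then obtain r2 where "step r Tau r2" using emits_commute[OF M] by blast
  then show ?thesis using stuck reduces.client_tau by metis
next
  case (communication \<mu>)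
  from communication(2) obtain r2 where r2: "step r (Vis (co \<mu>)) r2"
    using emits_commute[OF M] by blast
  from communication(1) show ?thesis
  proof cases
    case (fw_lift p')
    then show ?thesis using r2 stuck reduces.communication by metis
  next
    case (fw_out a N)
    then obtain r3 where "step r Tau r3"
      using emits_feedback[of r a N r' r1] M communication(2) by auto
    then show ?thesis using stuck reduces.client_tau by metis
  next
    case (fw_in a)
    then show ?thesis using communication(2) by auto
  qed
qed

lemma doomed_into_buffer:
  assumes "emits step r M r'" "doomed stepS step good p r"
  shows "doomed (fw_step stepS) step good (p \<triangleright> M) r'"
  using assms
proof (coinduction arbitrary: p M r r')
  case doomed
  have ng: "\<not> good r'" using doomed emits_good doomed_not_good by metis
  from doomed(2) show ?case
  proof cases
    case doomed_stuck
    show ?thesis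
    proof (cases "\<exists>x. reduces (fw_step stepS) step (p \<triangleright> M, r') x")
      case True
      then obtain P r1 where red: "reduces (fw_step stepS) step (p \<triangleright> M, r') (P, r1)" by auto
      then obtain a where a: "P = p \<triangleright> add_mset a M" "step r' (Vis (Out a)) r1"
        using stuck_into_buffer[OF doomed(1) doomed_stuck(2)] by blast
      \<comment> \<open>The flush is matched by no move of the unbuffered pair: coinduction
        continues with the same \<open>p\<close> and \<open>r\<close> and a larger multiset.\<close>
      have "emits step r (add_mset a M) r1" using emits_snoc[OF doomed(1) a(2)] .
      then show ?thesis using ng red a doomed(2) by blast
    qed (use ng in blast)
  next
    case (doomed_step p1 r1)
    then show ?thesis using reduces_into_buffer[OF doomed(1) doomed_step(2)] ng by blast
  qed
qed

text \<open>Conversely, flushing an output into the buffer is matched by no move at all, so that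
  termination of outputs is needed to make progress.\<close>

lemma reduces_out_of_buffer:
  assumes M: "emits step r M r'" and red: "reduces (fw_step stepS) step (p \<triangleright> M, r') (P, r1)"
  shows "(\<exists>a. P = p \<triangleright> add_mset a M \<and> step r' (Vis (Out a)) r1) \<or>
    (\<exists>p2 M2 r2. P = p2 \<triangleright> M2 \<and> emits step r2 M2 r1 \<and> reduces stepS step (p, r) (p2, r2))"
  using red
proof cases
  case server_tau
  from server_tau(2) show ?thesis
  proof cases
    case (fw_lift p')
    then show ?thesis using M server_tau reduces.server_tau by metis
  next
    case (fw_comm a p' N)
    then obtain r2 where "step r (Vis (Out a)) r2" "emits step r2 N r'"
      using emits_extract[OF M, of a] by auto
    then show ?thesis
      using fw_comm server_tau reduces.communication[of stepS p "In a"] by (metis co.simps(1))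
  qed
next
  case client_tau
  then obtain r2 where "step r Tau r2" "emits step r2 M r1" using emits_commute[OF M] by blast
  then show ?thesis using client_tau reduces.client_tau by metis
next
  case (communication \<mu>)
  from communication(1) show ?thesis
  proof cases
    case (fw_lift p')
    from communication(2) obtain r2 where "step r (Vis (co \<mu>)) r2" "emits step r2 M r1"
      using emits_commute[OF M] by blast
    then show ?thesis using fw_lift reduces.communication by metis
  next
    case (fw_out a N)
    then obtain r2 where "step r Tau r2" "emits step r2 N r1"
      using emits_feedback[of r a N r' r1] M communication(2) by auto
    then show ?thesis using fw_out reduces.client_tau by metis
  next
    case (fw_in a)
    then show ?thesis using communication(2) by auto
  qed
qed

lemma stuck_out_of_buffer:
  assumes M: "emits step r M r'" and stuck: "\<And>x. \<not> reduces (fw_step stepS) step (p \<triangleright> M, r') x"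
  shows "\<not> reduces stepS step (p, r) x"
  using reduces_into_buffer[OF M] stuck by (metis prod.collapse)

text \<open>Induction over the outputs left in \<open>r'\<close> skips the flushes, which leave the
  unbuffered pair where it is, until a matched move or a stuck pair turns up.\<close>

lemma doomed_buffer_cases:
  assumes "emits step r M r'" "doomed (fw_step stepS) step good (p \<triangleright> M) r'"
  shows "(\<forall>x. \<not> reduces stepS step (p, r) x) \<or>
    (\<exists>p2 M2 r2 r2'. reduces stepS step (p, r) (p2, r2) \<and> emits step r2 M2 r2' \<and>
      doomed (fw_step stepS) step good (p2 \<triangleright> M2) r2')"
  using assms
proof (induction r' arbitrary: M rule: output_induct)
  case (emit r')
  from emit.prems(2) show ?case
  proof cases
    case doomed_stuck
    then show ?thesis by (intro disjI1 allI stuck_out_of_buffer[OF emit.prems(1)]) simp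
  next
    case (doomed_step P r1)
    from reduces_out_of_buffer[OF emit.prems(1) doomed_step(2)] show ?thesis
    proof (elim disjE exE conjE)
      fix a assume a: "P = p \<triangleright> add_mset a M" "step r' (Vis (Out a)) r1"
      then show ?thesis
        using emit.IH[OF a(2) emits_snoc[OF emit.prems(1) a(2)]] doomed_step(3) by simp
    next
      fix p2 M2 r2
      assume "P = p2 \<triangleright> M2" "emits step r2 M2 r1" "reduces stepS step (p, r) (p2, r2)"
      then show ?thesis using doomed_step(3) by blast
    qed
  qed
qed

lemma doomed_out_of_buffer:
  assumes "emits step r M r'" "doomed (fw_step stepS) step good (p \<triangleright> M) r'"
  shows "doomed stepS step good p r"
  using assms
proof (coinduction arbitrary: p M r r')
  case doomed
  have "\<not> good r" using doomed emits_good doomed_not_good by metis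
  with doomed_buffer_cases[OF doomed] show ?case by blast
qed

text \<open>With \<open>M\<close> empty this exchanges a server for its forwarding lifting; in
  general it moves messages between the two buffers.\<close>

lemma doomed_buffer_iff:
  assumes "emits step r M r'"
  shows "doomed (fw_step stepS) step good (p \<triangleright> M) r' \<longleftrightarrow> doomed stepS step good p r"
  by (rule iffI) (erule doomed_out_of_buffer[OF assms], erule doomed_into_buffer[OF assms])

end

section \<open>Soundness of the must-set preorder\<close>

text \<open>Failures that show after finitely many moves of the client, by divergence or deadlock;
  what remains are computations in which the client moves infinitely often.\<close>

definition offends ::
  "('s, 'n) trans \<Rightarrow> ('c, 'n) trans \<Rightarrow> ('c \<Rightarrow> bool) \<Rightarrow> 's \<Rightarrow> 'c \<Rightarrow> bool" where
  "offends step stepC good p r \<longleftrightarrow> (\<exists>s p' r'. client_run stepC good r s r' \<and> weak step p s p' \<and>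
    (\<not> converges step p' \<or> (\<forall>x. \<not> reduces step stepC (p', r') x)))"

lemma offends_tau:
  assumes "step p Tau p'" "offends step stepC good p' r"
  shows "offends step stepC good p r"
  using assms weak_tau[of step p p'] unfolding offends_def by metis

lemma offends_client_step:
  assumes "stepC r l r'" "\<not> good r" "weak step p (co_trace l) p'" "offends step stepC good p' r'"
  shows "offends step stepC good p r"
proof -
  obtain s p1 r1 where run: "client_run stepC good r' s r1" "weak step p' s p1"
    "\<not> converges step p1 \<or> (\<forall>x. \<not> reduces step stepC (p1, r1) x)"
    using assms(4) unfolding offends_def by metis
  have "client_run stepC good r (co_trace l @ s) r1"
    using client_run_step[OF assms(1,2) run(1)] .
  moreover have "weak step p (co_trace l @ s) p1" using weak_append[OF assms(3) run(2)] .
  ultimately show ?thesis using run(3) unfolding offends_def by metis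
qed

text \<open>Without an offence the server converges, so it makes only finitely many silent moves
  before the client takes part. A later offence, prefixed by the moves made so far, would be an
  offence at the start.\<close>

lemma doomed_progress:
  assumes "doomed step stepC good p r" "\<not> offends step stepC good p r"
  shows "\<exists>l p' r'. stepC r l r' \<and> weak step p (co_trace l) p' \<and>
    doomed step stepC good p' r' \<and> \<not> offends step stepC good p' r'"
proof -
  have ng: "\<not> good r" using assms(1) by (rule doomed_not_good)
  have run: "client_run stepC good r [] r" using ng by (rule client_run_Nil)
  have "converges step p"
    using assms(2) run weak_refl[of step p] unfolding offends_def by metis
  then show ?thesis
    using assms
  proof (induction rule: converges_induct)
    case (tau p)
    from tau.prems(1) show ?case
    proof cases
      case doomed_stuck
      then show ?thesis
        using tau.prems(2) run weak_refl[of step p] unfolding offends_def by metis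
    next
      case (doomed_step p' r')
      from doomed_step(2) show ?thesis
      proof cases
        case server_tau
        obtain l p2 r2 where "stepC r l r2" "weak step p' (co_trace l) p2"
          "doomed step stepC good p2 r2" "\<not> offends step stepC good p2 r2"
          using tau.IH[OF server_tau(2)] doomed_step(3) server_tau(1) tau.prems(2)
            offends_tau[of step p p' stepC good r, OF server_tau(2)] by auto
        then show ?thesis using weak_tau[of step p p', OF server_tau(2)] by blast
      next
        case client_tau
        have w: "weak step p (co_trace Tau) p" by (simp add: weak_refl)
        show ?thesis
          using client_tau doomed_step(3) w offends_client_step[of stepC r Tau r' good step p p, OF client_tau(2) ng w] tau.prems(2)
          by blast
      next
        case (communication \<mu>)
        have w: "weak step p (co_trace (Vis (co \<mu>))) p'"
          using weak_single[of step, OF communication(1)] by simp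
        show ?thesis
          using communication(2) doomed_step(3) w
            offends_client_step[of stepC r _ r' good step p p', OF communication(2) ng w] tau.prems(2)
          by blast
      qed
    qed
  qed
qed

lemma doomed_infinite_run:
  assumes "doomed step stepC good p r" "\<not> offends step stepC good p r"
  shows "\<exists>g l ps. g (0 :: nat) = r \<and> ps 0 = p \<and> (\<forall>i. stepC (g i) (l i) (g (Suc i))) \<and>
    (\<forall>i. \<not> good (g i)) \<and> (\<forall>i. weak step (ps i) (co_trace (l i)) (ps (Suc i)))"
proof -
  define I where "I x \<longleftrightarrow> doomed step stepC good (fst x) (snd x) \<and>
    \<not> offends step stepC good (fst x) (snd x)" for x
  define E where "E x y l \<longleftrightarrow> stepC (snd x) l (snd y) \<and> weak step (fst x) (co_trace l) (fst y)"
    for x y l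
  have E: "\<exists>y. I y \<and> (\<exists>l. E x y l)" if "I x" for x
    using doomed_progress[of step stepC good "fst x" "snd x"] that unfolding I_def E_def
    by (metis fst_conv snd_conv)
  \<comment> \<open>The clause for \<open>i = 0\<close> fixes the starting pair, which dependent
    choice would leave open.\<close>
  have "\<exists>f. \<forall>i. (I (f i) \<and> (i = 0 \<longrightarrow> f i = (p, r))) \<and> (\<exists>l. E (f i) (f (Suc i)) l)"
    by (rule dependent_nat_choice) (use E assms in \<open>auto simp: I_def\<close>)
  then obtain f where f: "\<forall>i. (I (f i) \<and> (i = 0 \<longrightarrow> f i = (p, r))) \<and> (\<exists>l. E (f i) (f (Suc i)) l)"
    by (rule exE)
  then have "\<forall>i. \<exists>l. E (f i) (f (Suc i)) l" by simp
  then obtain l where l: "\<forall>i. E (f i) (f (Suc i)) (l i)" by metis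
  have "\<not> good (snd (f i))" for i
    using f doomed_not_good[of step stepC good "fst (f i)" "snd (f i)"] by (simp add: I_def)
  then show ?thesis
    using f l unfolding E_def
    by (intro exI[of _ "snd \<circ> f"] exI[of _ l] exI[of _ "fst \<circ> f"]) simp
qed

text \<open>Indices count the moves of the client, with \<open>n\<close> excluded; silent moves
  contribute no action, so an infinite run may have a finite trace.\<close>

definition run_trace :: "(nat \<Rightarrow> 'n label) \<Rightarrow> nat \<Rightarrow> nat \<Rightarrow> 'n act list" where
  "run_trace l i n = concat (map (\<lambda>j. co_trace (l j)) [i..<n])"

lemma run_trace_refl [simp]: "run_trace l i i = []"
  by (simp add: run_trace_def)

lemma run_trace_Suc: "i < n \<Longrightarrow> run_trace l i n = co_trace (l i) @ run_trace l (Suc i) n"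
  by (simp add: run_trace_def upt_rec)

lemma run_trace_append: "i \<le> m \<Longrightarrow> m \<le> n \<Longrightarrow> run_trace l i n = run_trace l i m @ run_trace l m n"
  unfolding run_trace_def by (metis concat_append le_Suc_ex map_append upt_add_eq_append)

lemma client_run_trace:
  assumes "\<And>i. stepC (g i) (l i) (g (Suc i))" "\<And>i. \<not> good (g i)" "i \<le> n"
  shows "client_run stepC good (g i) (run_trace l i n) (g n)"
  using assms(3)
proof (induction rule: inc_induct)
  case (step m)
  then show ?case
    using client_run_step[of stepC "g m" "l m" "g (Suc m)" good, OF assms(1,2)] by (simp add: run_trace_Suc)
qed (simp add: client_run_Nil assms(2))

lemma weak_run_trace:
  assumes "\<And>i. weak step (ps i) (co_trace (l i)) (ps (Suc i))" "i \<le> n"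
  shows "weak step (ps i) (run_trace l i n) (ps n)"
  using assms(2)
  by (induction rule: inc_induct)
    (simp_all add: weak_refl run_trace_Suc weak_append[OF assms(1)])

text \<open>Koenig's lemma: in an image-finite system, a state with a weak transition along every
  finite prefix of an infinite trace, and convergent along these, has an infinite one.\<close>

lemma doomed_along_run:
  assumes fin: "image_finite step"
    and run: "\<And>i. stepC (g i) (l i) (g (Suc i))" "\<And>i. \<not> good (g i)"
    and conv: "\<And>n. converges_along step p (run_trace l 0 n)"
    and ex: "\<And>n. \<exists>p'. weak step p (run_trace l 0 n) p'"
  shows "doomed step stepC good p (g 0)"
proof -
  \<comment> \<open>The branches to be kept in Koenig's lemma: every longer prefix of the run is
    still possible from them.\<close>
  define alive where "alive i p \<longleftrightarrow> (\<forall>n\<ge>i. converges_along step p (run_trace l i n) \<and>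
    (\<exists>p'. weak step p (run_trace l i n) p'))" for i p
  have alive_step: "\<exists>p'. weak step p (co_trace (l i)) p' \<and> alive (Suc i) p'" if "alive i p" for i p
  proof (rule ccontr)
    assume none: "\<not> ?thesis"
    let ?S = "{p'. weak step p (co_trace (l i)) p'}"
    have "converges_along step p (co_trace (l i))"
      using that run_trace_Suc[of i "Suc i" l] unfolding alive_def by (metis append_Nil2 le_add2
          lessI plus_1_eq_Suc run_trace_refl)
    then have finS: "finite ?S" by (rule finite_weak[OF fin])
    have dead: "\<exists>n\<ge>Suc i. \<nexists>p''. weak step p' (run_trace l (Suc i) n) p''" if p': "p' \<in> ?S" for p'
    proof -
      have "converges_along step p' (run_trace l (Suc i) n)" if "n \<ge> Suc i" for n
      proof -
        have "converges_along step p (run_trace l i n)"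
          using \<open>alive i p\<close> that unfolding alive_def by (meson Suc_leD)
        then show ?thesis using p' that by (auto simp: run_trace_Suc intro: converges_along_append)
      qed
      then show ?thesis using none p' unfolding alive_def by blast
    qed
    then obtain N where N: "\<And>p'. p' \<in> ?S \<Longrightarrow>
        N p' \<ge> Suc i \<and> (\<nexists>p''. weak step p' (run_trace l (Suc i) (N p')) p'')"
      by metis
    \<comment> \<open>The derivatives are finitely many, so one index lies past the point where each
      of them fails; the derivative used by a transition up to \<open>n\<close> yields the
      contradiction. Inserting \<open>Suc i\<close> covers an empty \<open>?S\<close>.\<close>
    define n where "n = Max (insert (Suc i) (N ` ?S))"
    have n: "Suc i \<le> n" "\<And>p'. p' \<in> ?S \<Longrightarrow> N p' \<le> n"
      using finS by (simp_all add: n_def)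
    have "run_trace l i n = co_trace (l i) @ run_trace l (Suc i) n"
      using n(1) by (simp add: run_trace_Suc)
    then have "\<exists>p''. weak step p (co_trace (l i) @ run_trace l (Suc i) n) p''"
      using \<open>alive i p\<close> n(1) unfolding alive_def by (metis Suc_leD)
    then obtain p'' where "weak step p (co_trace (l i) @ run_trace l (Suc i) n) p''" by blast
    then obtain p' where p': "p' \<in> ?S" "weak step p' (run_trace l (Suc i) n) p''"
      using weak_split by fastforce
    then have "weak step p' (run_trace l (Suc i) (N p') @ run_trace l (N p') n) p''"
      using N n by (simp flip: run_trace_append)
    then show False using weak_split N[OF p'(1)] by metis
  qed
  have "alive 0 p" using conv ex by (simp add: alive_def)
  \<comment> \<open>The server answers \<open>l i\<close> by several moves, of which the pair makes
    one at a time; \<open>p\<close> may be any state before the end of this answer.\<close>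
  define follows where "follows p r \<longleftrightarrow>
    (\<exists>i p'. r = g i \<and> weak step p (co_trace (l i)) p' \<and> alive (Suc i) p')" for p r
  have follows_step: "\<not> good r \<and> (\<exists>p1 r1. reduces step stepC (p, r) (p1, r1) \<and> follows p1 r1)"
    if "follows p r" for p r
  proof
    obtain i p' where r: "r = g i" and w: "weak step p (co_trace (l i)) p'"
      and al: "alive (Suc i) p'" using \<open>follows p r\<close> unfolding follows_def by metis
    show "\<not> good r" using run(2) r by simp
    obtain p2 where p2: "weak step p' (co_trace (l (Suc i))) p2" "alive (Suc (Suc i)) p2"
      using alive_step[OF al] by metis
    show "\<exists>p1 r1. reduces step stepC (p, r) (p1, r1) \<and> follows p1 r1"
      using w
    proof cases
      case weak_refl
      then have "l i = Tau" by (cases "l i") auto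
      then have "reduces step stepC (p, r) (p, g (Suc i))"
        using run(1)[of i] r by (auto intro: client_tau)
      moreover have "follows p (g (Suc i))" using p2 weak_refl unfolding follows_def by blast
      ultimately show ?thesis by blast
    next
      case (weak_tau p1)
      then have "follows p1 r" using r al unfolding follows_def by blast
      then show ?thesis using server_tau[of step p p1 stepC r] weak_tau(1) by blast
    next
      case (weak_act \<mu> p1 s)
      then have l: "l i = Vis (co \<mu>)" "s = []" by (cases "l i"; auto)+
      have "reduces step stepC (p, r) (p1, g (Suc i))"
        using communication[of step p \<mu> p1 stepC r] weak_act run(1)[of i] l r by simp
      \<comment> \<open>Silent moves closing one answer are postponed to the beginning of the
        next.\<close>
      moreover have "weak step p1 (co_trace (l (Suc i))) p2"
        using weak_append[of step p1 "[]" p'] weak_act l p2(1) by simp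
      then have "follows p1 (g (Suc i))" using p2(2) unfolding follows_def by blast
      ultimately show ?thesis by blast
    qed
  qed
  have "follows p (g 0)" using alive_step[OF \<open>alive 0 p\<close>] unfolding follows_def by blast
  then show ?thesis by (rule doomed.coinduct) (use follows_step in blast)
qed

lemma MS_preorder_doomed:
  assumes fin: "image_finite stepA"
    and finite_outputs: "\<And>p. finite (outputs stepA p)"
    and receptive: "\<And>q a. \<exists>q'. stepB q (Vis (In a)) q'"
    and MS: "MS_preorder stepA stepB p q"
    and doomed: "doomed stepB stepC good q r"
  shows "doomed stepA stepC good p r"
proof (cases "offends stepB stepC good q r")
  case True
  then obtain s q' r' where run: "client_run stepC good r s r'" and q': "weak stepB q s q'"
    and off: "\<not> converges stepB q' \<or> (\<forall>x. \<not> reduces stepB stepC (q', r') x)"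
    unfolding offends_def by metis
  show ?thesis
  proof (cases "converges_along stepA p s")
    case False
    then show ?thesis by (rule doomed_not_converges_along[OF run])
  next
    case conv: True
    then have "converges_along stepB q (s @ [])"
      using MS by (simp add: MS_preorder_def cnv_preorder_def)
    from converges_along_append[OF this q'] have "converges stepB q'"
      by (simp add: converges_along_Nil_iff)
    then have stuck: "\<not> reduces stepB stepC (q', r') x" for x using off by blast
    \<comment> \<open>The outputs that the worse server may offer after \<open>s\<close> and the
      client accepts. The deadlock at \<open>q'\<close> refuses them all, hence so does some
      derivative of the worse server, and a stable state below it will be stuck as well.\<close>
    define X where "X = {\<mu> \<in> (\<Union>p'\<in>after stepA p s. outputs stepA p'). \<exists>r''. stepC r' (Vis (co \<mu>)) r''}"
    have "finite X"
      using finite_weak[OF fin conv] finite_outputs by (simp add: X_def after_def)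
    have refuse: "\<not> weak stepB q' [\<mu>] q''" if "\<mu> \<in> X" for \<mu> q''
    proof
      assume "weak stepB q' [\<mu>] q''"
      then show False
      proof cases
        case (weak_tau q1)
        then show False using stuck server_tau by metis
      next
        case (weak_act q1)
        moreover from that obtain r'' where "stepC r' (Vis (co \<mu>)) r''" by (auto simp: X_def)
        ultimately show False using stuck communication by metis
      qed
    qed
    then have "\<not> must_set stepB q' X" using weak_refl[of stepB q'] unfolding must_set_def by blast
    then obtain p' where p': "weak stepA p s p'" "\<not> must_set stepA p' X"
      using MS q' conv \<open>finite X\<close> unfolding MS_preorder_def M_preorder_def after_def by blast
    then obtain p1 where p1: "weak stepA p' [] p1" "\<And>\<mu> p''. \<mu> \<in> X \<Longrightarrow> \<not> weak stepA p1 [\<mu>] p''"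
      unfolding must_set_def by blast
    have sp1: "weak stepA p s p1" using weak_append[OF p'(1) p1(1)] by simp
    have "converges stepA p1"
      using converges_along_append[of stepA p s "[]" p1] conv sp1
      by (simp add: converges_along_Nil_iff)
    then obtain p2 where p2: "weak stepA p1 [] p2" "\<And>p''. \<not> stepA p2 Tau p''"
      using converges_reaches_stable by metis
    have sp2: "weak stepA p s p2" using weak_append[OF sp1 p2(1)] by simp
    have "\<not> reduces stepA stepC (p2, r') x" for x
    proof
      assume "reduces stepA stepC (p2, r') x"
      then show False
      proof cases
        case (server_tau p3)
        then show False using p2 by simp
      next
        case (client_tau r'')
        then show False using stuck reduces.client_tau by metis
      next
        case (communication \<mu> p3 r'')
        show False
        proof (cases \<mu>)
          case (In a)
          \<comment> \<open>The better server accepts every input, so an output of the client would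
            already unblock \<open>q'\<close>.\<close>
          then show False using receptive[of q' a] communication stuck reduces.communication by metis
        next
          case (Out a)
          then have "\<mu> \<in> X" using communication sp2 by (auto simp: X_def after_def outputs_def)
          moreover have "weak stepA p1 [\<mu>] p3"
            using weak_append[OF p2(1) weak_single[of stepA, OF communication(2)]] by simp
          ultimately show False using p1(2) by simp
        qed
      qed
    qed
    then have "doomed stepA stepC good p2 r'"
      using client_run_not_good[OF run] by (rule doomed_stuck[rotated])
    then show ?thesis using doomed_client_run[OF run sp2] by simp
  qed
next
  case False
  then obtain g l qs where g: "g (0 :: nat) = r" "qs 0 = q"
    and run: "\<And>i. stepC (g i) (l i) (g (Suc i))" "\<And>i. \<not> good (g i)"
    and qs: "\<And>i. weak stepB (qs i) (co_trace (l i)) (qs (Suc i))"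
    using doomed_infinite_run[OF doomed] by metis
  show ?thesis
  proof (cases "\<forall>n. converges_along stepA p (run_trace l 0 n)")
    case True
    have "\<exists>p'. weak stepA p (run_trace l 0 n) p'" for n
    proof -
      have "weak stepB q (run_trace l 0 n) (qs n)"
        using weak_run_trace[of stepB qs l 0 n] qs g by simp
      \<comment> \<open>No state satisfies the empty must-set, so the preorder forces the worse
        server to have a derivative along the prefix.\<close>
      moreover have "\<not> must_set stepB (qs n) {}"
        using weak_refl[of stepB "qs n"] by (auto simp: must_set_def)
      ultimately show ?thesis
        using MS True unfolding MS_preorder_def M_preorder_def after_def by blast
    qed
    then show ?thesis using doomed_along_run[of stepA stepC g l good p, OF fin run] True g(1) by simp
  next
    case False
    then obtain n where "\<not> converges_along stepA p (run_trace l 0 n)" by blast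
    moreover have "client_run stepC good r (run_trace l 0 n) (g n)"
      using client_run_trace[of stepC g l good 0 n] run g(1) by simp
    ultimately show ?thesis using doomed_not_converges_along by metis
  qed
qed

section \<open>Finite branching and receptiveness of the forwarding lifting\<close>

lemma fw_image_finite:
  assumes "image_finite step"
  shows "image_finite (fw_step step)"
  unfolding image_finite_def
proof (intro allI)
  fix P :: "('a, 'b) fw_state" and \<alpha>
  obtain p M where P: "P = p \<triangleright> M" by (cases P)
  have "{P'. fw_step step P \<alpha> P'} \<subseteq>
      (\<lambda>p'. p' \<triangleright> M) ` {p'. step p \<alpha> p'} \<union>
      (\<Union>a\<in>set_mset M. (\<lambda>p'. p' \<triangleright> (M - {#a#})) ` {p'. step p (Vis (In a)) p'}) \<union>
      (\<lambda>a. p \<triangleright> (M - {#a#})) ` set_mset M \<union>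
      {p \<triangleright> add_mset a M | a. a \<in> {a. \<alpha> = Vis (In a)}}"
    unfolding P by (auto elim!: fw_step.cases)
  moreover have "finite {a. \<alpha> = Vis (In a)}"
    by (rule finite_subset[of _ "case \<alpha> of Vis (In a) \<Rightarrow> {a} | _ \<Rightarrow> {}"])
      (auto split: label.split act.split)
  ultimately show "finite {P'. fw_step step P \<alpha> P'}"
    using assms by (auto simp: image_finite_def intro: finite_subset)
qed

lemma fw_finite_outputs:
  assumes "finite (outputs step p)"
  shows "finite (outputs (fw_step step) (p \<triangleright> M))"
proof (rule finite_subset)
  show "outputs (fw_step step) (p \<triangleright> M) \<subseteq> outputs step p \<union> Out ` set_mset M"
    by (auto simp: outputs_def elim!: fw_step.cases)
qed (use assms in simp)

lemma fw_receptive: "\<exists>P'. fw_step step P (Vis (In a)) P'"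
  by (cases P) (blast intro: fw_in)

lemma must_preorder_if_MS_preorder:
  assumes A: "Fdb stepA" "image_finite stepA"
    and MS: "MS_preorder (fw_step stepA) (fw_step stepB) (p \<triangleright> {#}) (q \<triangleright> {#})"
  shows "must_preorder TYPE('c) stepA stepB p q"
  unfolding must_preorder_def
proof (intro allI impI)
  fix stepC :: "('c, 'b) trans" and good r
  assume "client stepC good" and must: "must stepA stepC good p r"
  then interpret C: client stepC good by simp
  have fin: "finite (outputs (fw_step stepA) P)" for P
    by (cases P) (simp add: fw_finite_outputs lts.finite_outputs[OF Fdb.axioms(1)[OF A(1)]])
  show "must stepB stepC good q r"
    using must MS_preorder_doomed[OF fw_image_finite[OF A(2)] fin fw_receptive MS, of stepC good r]
    by (simp add: must_iff_not_doomed C.doomed_buffer_iff[OF emits_empty]) blast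
qed

section \<open>Test clients\<close>

text \<open>\<open>N\<close> holds the messages released by a move of the core. Rule
  \<open>buffer_comm\<close>, by which the core reads a message of its own, is forced by the
  feedback axiom.\<close>

inductive buffer_step ::
  "('k \<Rightarrow> 'n label \<Rightarrow> 'k \<times> 'n multiset \<Rightarrow> bool) \<Rightarrow> ('k \<times> 'n multiset, 'n) trans" for core where
  buffer_core: "core k \<alpha> (k', N) \<Longrightarrow> buffer_step core (k, M) \<alpha> (k', N + M)"
| buffer_comm:
    "core k (Vis (In a)) (k', N) \<Longrightarrow> buffer_step core (k, add_mset a M) Tau (k', N + M)"
| buffer_out: "buffer_step core (k, add_mset a M) (Vis (Out a)) (k, M)"

lemma buffer_frame:
  assumes "buffer_step core (k, M) \<alpha> (k', M')"
  shows "buffer_step core (k, add_mset a M) \<alpha> (k', add_mset a M')"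
  using assms
proof cases
  case (buffer_core N)
  then show ?thesis using buffer_step.buffer_core[of core k \<alpha> k' N "add_mset a M"] by simp
next
  case (buffer_comm b N K)
  then show ?thesis
    using buffer_step.buffer_comm[of core k b k' N "add_mset a K"] by (simp add: add_mset_commute)
next
  case (buffer_out b)
  then show ?thesis
    using buffer_step.buffer_out[of core k b "add_mset a M'"] by (simp add: add_mset_commute)
qed

lemma emits_buffer: "emits (buffer_step core) (k, N + M) M (k, N)"
proof (induction M)
  case (add a M)
  then show ?case using emits_add[of "buffer_step core" "(k, add_mset a (N + M))" a "(k, N + M)" M "(k, N)"]
    by (simp add: buffer_out)
qed (simp add: emits_empty)

context
  fixes core :: "'k \<Rightarrow> 'n label \<Rightarrow> 'k \<times> 'n multiset \<Rightarrow> bool"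
  assumes core_no_output: "\<not> core k (Vis (Out a)) x"
begin

lemma buffer_output_cases:
  assumes "buffer_step core p (Vis (Out a)) p'"
  obtains k M where "p = (k, add_mset a M)" "p' = (k, M)"
  using assms by cases (auto simp: core_no_output)

text \<open>Every output takes a message from the multiset and leaves the core alone. It is
  independent of all core moves except the reading of that very message, which accounts for feedback
  and for the second alternative of output-tau.\<close>

lemma buffer_Fdb: "Fdb (buffer_step core)"
proof
  fix p :: "'k \<times> 'n multiset"
  have "outputs (buffer_step core) p \<subseteq> Out ` set_mset (snd p)"
    unfolding outputs_def by (auto elim!: buffer_output_cases)
  then show "finite (outputs (buffer_step core) p)" by (rule finite_subset) simp
next
  fix p a p' \<alpha> q
  assume "buffer_step core p (Vis (Out a)) p'" and q: "buffer_step core p' \<alpha> q"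
  then obtain k M where p: "p = (k, add_mset a M)" "p' = (k, M)" by (auto elim: buffer_output_cases)
  obtain k' M' where q': "q = (k', M')" by (cases q)
  show "\<exists>p''. buffer_step core p \<alpha> p'' \<and> buffer_step core p'' (Vis (Out a)) q"
    using buffer_frame[of core k M \<alpha> k' M' a] buffer_out[of core k' a M'] q p q' by blast
next
  fix p a p' q
  assume "buffer_step core p (Vis (Out a)) p'" and q: "buffer_step core p' (Vis (In a)) q"
  then obtain k M where p: "p = (k, add_mset a M)" "p' = (k, M)" by (auto elim: buffer_output_cases)
  show "buffer_step core p Tau q"
    using q unfolding p by cases (auto intro: buffer_comm)
next
  fix p a p' p''
  assume "buffer_step core p (Vis (Out a)) p'" "buffer_step core p (Vis (Out a)) p''"
  then show "p' = p''" by (auto elim!: buffer_output_cases)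
next
  fix p a p' p''
  assume "buffer_step core p' (Vis (Out a)) p" "buffer_step core p'' (Vis (Out a)) p"
  then show "p' = p''" by (auto elim!: buffer_output_cases)
next
  fix p a p' p''
  assume "buffer_step core p (Vis (Out a)) p'" and p'': "buffer_step core p Tau p''"
  then obtain k M where p: "p = (k, add_mset a M)" "p' = (k, M)" by (auto elim: buffer_output_cases)
  show "(\<exists>q. buffer_step core p' Tau q \<and> buffer_step core p'' (Vis (Out a)) q) \<or>
      buffer_step core p' (Vis (In a)) p''"
    using p'' unfolding p
  proof cases
    case (buffer_core k' N)
    have "buffer_step core p'' (Vis (Out a)) (k', N + M)"
      using buffer_out[of core k' a "N + M"] buffer_core by simp
    then show "(\<exists>q. buffer_step core (k, M) Tau q \<and> buffer_step core p'' (Vis (Out a)) q) \<or>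
      buffer_step core (k, M) (Vis (In a)) p''"
      using buffer_step.buffer_core[of core k Tau k' N M] buffer_core by blast
  next
    case (buffer_comm b k' N K)
    show "(\<exists>q. buffer_step core (k, M) Tau q \<and> buffer_step core p'' (Vis (Out a)) q) \<or>
      buffer_step core (k, M) (Vis (In a)) p''"
    \<comment> \<open>The message read silently either is the emitted one, giving the second
      alternative, or lies in the buffer besides it.\<close>
    proof (cases "a = b")
      case True
      then show ?thesis
        using buffer_comm buffer_step.buffer_core[of core k "Vis (In a)" k' N M] by simp
    next
      case False
      then obtain L where L: "M = add_mset b L" "K = add_mset a L"
        using buffer_comm(1) by (auto simp: add_eq_conv_ex)
      have "buffer_step core p'' (Vis (Out a)) (k', N + L)"
        using buffer_out[of core k' a "N + L"] buffer_comm L by simp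
      then show ?thesis using buffer_step.buffer_comm[of core k b k' N L] buffer_comm L by blast
    qed
  qed
next
  fix p a p' \<alpha> p''
  assume "buffer_step core p (Vis (Out a)) p'" and p'': "buffer_step core p \<alpha> p''"
    and \<alpha>: "\<alpha> \<notin> {Vis (Out a), Tau}"
  then obtain k M where p: "p = (k, add_mset a M)" "p' = (k, M)" by (auto elim: buffer_output_cases)
  show "\<exists>q. buffer_step core p' \<alpha> q \<and> buffer_step core p'' (Vis (Out a)) q"
    using p'' unfolding p
  proof cases
    case (buffer_core k' N)
    have "buffer_step core p'' (Vis (Out a)) (k', N + M)"
      using buffer_out[of core k' a "N + M"] buffer_core by simp
    then show "\<exists>q. buffer_step core (k, M) \<alpha> q \<and> buffer_step core p'' (Vis (Out a)) q"
      using buffer_step.buffer_core[of core k \<alpha> k' N M] buffer_core by blast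
  next
    case (buffer_out b K)
    then obtain L where L: "M = add_mset b L" "K = add_mset a L"
      using \<alpha> by (auto simp: add_eq_conv_ex)
    then show "\<exists>q. buffer_step core (k, M) \<alpha> q \<and> buffer_step core p'' (Vis (Out a)) q"
      using buffer_step.buffer_out[of core k b L] buffer_step.buffer_out[of core k a L] buffer_out
      by auto
  qed (use \<alpha> in auto)
qed

lemma buffer_client:
  assumes "\<And>k M N. good (k, M) \<longleftrightarrow> good (k, N)"
  shows "client (buffer_step core) good"
proof (intro client.intro[OF buffer_Fdb] client_axioms.intro)
  fix r a r'
  assume "buffer_step core r (Vis (Out a)) r'"
  then show "good r \<longleftrightarrow> good r'" using assms by (auto elim!: buffer_output_cases)
next
  show "\<not> (\<exists>f. \<forall>i. \<exists>a. buffer_step core (f i) (Vis (Out a)) (f (Suc i)))"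
  proof
    assume "\<exists>f. \<forall>i. \<exists>a. buffer_step core (f i) (Vis (Out a)) (f (Suc i))"
    then obtain f where f: "\<forall>i. \<exists>a. buffer_step core (f i) (Vis (Out a)) (f (Suc i))" by (rule exE)
    have size: "size (snd (f i)) = Suc (size (snd (f (Suc i))))" for i
    proof -
      obtain a where "buffer_step core (f i) (Vis (Out a)) (f (Suc i))" using f by blast
      then show ?thesis by (rule buffer_output_cases) simp
    qed
    have "size (snd (f i)) + i = size (snd (f 0))" for i
    proof (induction i)
      case (Suc i)
      then show ?case using size[of i] by simp
    qed simp
    from this[of "Suc (size (snd (f 0)))"] show False by simp
  qed
qed

end

text \<open>The client testing the trace \<open>s\<close> keeps the messages it has to send first in its buffer. It
  may succeed silently instead of waiting for an output of the server, so that it fails only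
  if the server diverges along \<open>s\<close> or the final test, which succeeds on the labels in \<open>F\<close>, fails.\<close>

fun test :: "'n act list \<Rightarrow> 'n act list option \<times> 'n multiset" where
  "test [] = (Some [], {#})"
| "test (In a # s) = apsnd (add_mset a) (test s)"
| "test (Out b # s) = (Some (Out b # s), {#})"

inductive test_core ::
  "'n label set \<Rightarrow> 'n act list option \<Rightarrow> 'n label \<Rightarrow> 'n act list option \<times> 'n multiset \<Rightarrow> bool"
  for F where
  test_core_input: "test_core F (Some (Out b # s)) (Vis (In b)) (test s)"
| test_core_skip: "test_core F (Some (Out b # s)) Tau (None, {#})"
| test_core_final: "\<lbrakk>l \<in> F; \<And>a. l \<noteq> Vis (Out a)\<rbrakk> \<Longrightarrow> test_core F (Some []) l (None, {#})"

abbreviation "test_step F \<equiv> buffer_step (test_core F)"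

definition passed :: "'n act list option \<times> 'n multiset \<Rightarrow> bool" where
  "passed x \<longleftrightarrow> fst x = None"

lemma test_client: "client (test_step F) passed"
  by (rule buffer_client) (auto simp: passed_def elim: test_core.cases)

section \<open>Moves of the test clients\<close>

lemma not_passed_test: "\<not> passed (test s)"
  by (induction s rule: test.induct) (auto simp: passed_def)

text \<open>A test releases messages only up to the first output it expects, so the buffer is empty
  in this state and only the core can move.\<close>

lemma test_step_Out_cases:
  assumes "test_step F (test (Out b # s)) l y"
  shows "(l = Tau \<and> passed y) \<or> (l = Vis (In b) \<and> y = test s)"
  using assms by (auto simp: passed_def elim!: buffer_step.cases test_core.cases)

lemma test_step_Nil_cases:
  assumes "test_step F (test []) l y"
  shows "l \<in> F \<and> passed y"
  using assms by (auto simp: passed_def elim!: buffer_step.cases test_core.cases)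

lemma test_step_skip: "test_step F (test (Out b # s)) Tau (None, {#})"
  using buffer_core[of "test_core F" "Some (Out b # s)" Tau None "{#}" "{#}"]
  by (simp add: test_core_skip)

lemma test_step_final:
  assumes "l \<in> F" "\<And>a. l \<noteq> Vis (Out a)"
  shows "test_step F (test []) l (None, {#})"
  using buffer_core[of "test_core F" "Some []" l None "{#}" "{#}"]
  by (simp add: test_core_final[OF assms])

lemma test_step_Cons: "test_step F (test (\<mu> # s)) (Vis (co \<mu>)) (test s)"
proof (cases \<mu>)
  case (In a)
  then show ?thesis by (cases "test s") (simp add: buffer_out)
next
  case (Out b)
  obtain k M where s: "test s = (k, M)" by (cases "test s")
  have "test_core F (Some (Out b # s)) (Vis (In b)) (k, M)"
    using test_core_input[of F b s] s by simp
  then show ?thesis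
    using buffer_core[of "test_core F" "Some (Out b # s)" "Vis (In b)" k M "{#}"] Out s by simp
qed

lemma test_run: "client_run (test_step F) passed (test s) s (test [])"
proof (induction s)
  case (Cons \<mu> s)
  then show ?case
    using client_run_step[of "test_step F" "test (\<mu> # s)" "Vis (co \<mu>)" "test s" passed s "test []"]
      test_step_Cons not_passed_test by fastforce
qed (rule client_run_Nil, rule not_passed_test)

text \<open>An input heading the trace is shifted from the buffer of the test into that of the
  server, which amounts to an input transition of the forwarder. Before an output, convergence
  bounds the silent moves of the server, and a silent move of the test is a success.\<close>

lemma test_not_doomed:
  assumes "converges_along (fw_step step) P s"
    and "\<And>P'. \<lbrakk>weak (fw_step step) P s P'; converges (fw_step step) P'\<rbrakk>
      \<Longrightarrow> \<not> doomed (fw_step step) (test_step F) passed P' (test [])"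
  shows "\<not> doomed (fw_step step) (test_step F) passed P (test s)"
  using assms
proof (induction s arbitrary: P rule: list.induct)
  case Nil
  then show ?case using weak_refl by (metis converges_along_Nil_iff)
next
  case (Cons \<mu> s)
  have conv: "converges (fw_step step) P" using Cons.prems(1) by (rule converges_along_imp_converges)
  have IH: "\<not> doomed (fw_step step) (test_step F) passed P' (test s)"
    if "weak (fw_step step) P [\<mu>] P'" for P'
    using Cons.IH[of P'] Cons.prems that weak_append[OF that]
    by (simp add: converges_along_Cons_iff)
  show ?case
  proof (cases \<mu>)
    case (In a)
    obtain p M where P: "P = p \<triangleright> M" by (cases P)
    obtain k N where s: "test s = (k, N)" by (cases "test s")
    interpret C: client "test_step F" passed by (rule test_client)
    \<comment> \<open>The unbuffered server serves as a go-between: \<open>M\<close> is handed to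
      the client, and \<open>add_mset a M\<close> is taken back.\<close>
    have "doomed (fw_step step) (test_step F) passed P (test (\<mu> # s)) \<longleftrightarrow>
        doomed step (test_step F) passed p (k, add_mset a N + M)"
      using C.doomed_buffer_iff[OF emits_buffer[of "test_core F" k "add_mset a N" M]] P s In by simp
    also have "\<dots> \<longleftrightarrow> doomed step (test_step F) passed p (k, N + add_mset a M)" by simp
    also have "\<dots> \<longleftrightarrow> doomed (fw_step step) (test_step F) passed (p \<triangleright> add_mset a M) (test s)"
      unfolding s by (rule C.doomed_buffer_iff[OF emits_buffer, symmetric])
    finally show ?thesis using IH weak_single[of "fw_step step", OF fw_in[of step p M a]] P In by simp
  next
    case (Out b)
    from conv IH show ?thesis unfolding Out
    proof (induction rule: converges_induct)
      case (tau P)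
      show ?case
      proof (rule not_doomedI)
        show "reduces (fw_step step) (test_step F) (P, test (Out b # s)) (P, (None, {#}))"
          by (rule client_tau, rule test_step_skip)
        fix P' r'
        assume "reduces (fw_step step) (test_step F) (P, test (Out b # s)) (P', r')"
        then show "\<not> doomed (fw_step step) (test_step F) passed P' r'"
        proof cases
          case server_tau
          then show ?thesis using tau.IH[of P'] tau.prems weak_tau[of "fw_step step" P P', OF server_tau(2)] by blast
        next
          case client_tau
          then have "passed r'" using test_step_Out_cases[of F b s Tau r'] by simp
          then show ?thesis using doomed_not_good by metis
        next
          case (communication \<mu>)
          then have "co \<mu> = In b" "r' = test s"
            using test_step_Out_cases[of F b s "Vis (co \<mu>)" r'] by auto
          then have "\<mu> = Out b" by (cases \<mu>) auto
          then show ?thesis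
            using tau.prems weak_single[of "fw_step step", OF communication(1)] \<open>r' = test s\<close> by simp
        qed
      qed
    qed
  qed
qed

text \<open>As the final test may succeed silently, only divergence of the server can make it
  fail.\<close>

lemma convergence_test:
  assumes "converges step P"
  shows "\<not> doomed step (test_step {Tau}) passed P (test [])"
  using assms
proof (induction rule: converges_induct)
  case (tau P)
  show ?case
  proof (rule not_doomedI)
    show "reduces step (test_step {Tau}) (P, test []) (P, (None, {#}))"
      by (rule client_tau, rule test_step_final) auto
    fix P' r'
    assume "reduces step (test_step {Tau}) (P, test []) (P', r')"
    then show "\<not> doomed step (test_step {Tau}) passed P' r'"
    proof cases
      case server_tau
      then show ?thesis using tau.IH by simp
    next
      case client_tau
      then show ?thesis using test_step_Nil_cases doomed_not_good by metis
    next
      case (communication \<mu>)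
      then show ?thesis using test_step_Nil_cases[OF communication(2)] by simp
    qed
  qed
qed

text \<open>\<open>Tau\<close> is absent, so that the final test has to wait for an output in
  \<open>X\<close>.\<close>

definition ready_labels :: "'n act set \<Rightarrow> 'n label set" where
  "ready_labels X = {Vis (In a) | a. Out a \<in> X}"

lemma must_set_test:
  assumes "converges step P" "must_set step P X" and X: "\<And>a. In a \<notin> X"
  shows "\<not> doomed step (test_step (ready_labels X)) passed P (test [])"
  using assms(1,2)
proof (induction rule: converges_induct)
  case (tau P)
  have "\<exists>x. reduces step (test_step (ready_labels X)) (P, test []) x"
  proof (cases "\<exists>P'. step P Tau P'")
    case True
    then show ?thesis by (blast intro: server_tau)
  next
    case False
    obtain \<mu> P' where \<mu>: "\<mu> \<in> X" "weak step P [\<mu>] P'"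
      using tau.prems weak_refl unfolding must_set_def by metis
    \<comment> \<open>As \<open>P\<close> is stable, the weak transition begins with the visible
      action itself, which the test can receive.\<close>
    from \<mu>(2) False obtain P1 where P1: "step P (Vis \<mu>) P1" by cases auto
    obtain a where a: "\<mu> = Out a" using X \<mu>(1) by (cases \<mu>) auto
    then have "test_step (ready_labels X) (test []) (Vis (co \<mu>)) (None, {#})"
      using \<mu>(1) by (intro test_step_final) (auto simp: ready_labels_def)
    then show ?thesis
      using communication[of step P \<mu> P1 "test_step (ready_labels X)" "test []"] P1 by blast
  qed
  then obtain x where "reduces step (test_step (ready_labels X)) (P, test []) x" by (rule exE)
  then show ?case
  proof (rule not_doomedI)
    fix P' r'
    assume "reduces step (test_step (ready_labels X)) (P, test []) (P', r')"
    then show "\<not> doomed step (test_step (ready_labels X)) passed P' r'"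
    proof cases
      case server_tau
      have "must_set step P' X"
        using tau.prems weak_tau[of step P P', OF server_tau(2)] unfolding must_set_def by blast
      then show ?thesis using tau.IH server_tau by simp
    next
      case client_tau
      then show ?thesis using test_step_Nil_cases doomed_not_good by metis
    next
      case (communication \<mu>)
      then show ?thesis using test_step_Nil_cases doomed_not_good by metis
    qed
  qed
qed

text \<open>A state refusing \<open>X\<close> diverges or has a stable derivative, which still
  refuses \<open>X\<close> and is therefore stuck with the final test.\<close>

lemma not_must_set_doomed:
  assumes "\<not> must_set step P X"
  shows "doomed step (test_step (ready_labels X)) passed P (test [])"
proof -
  obtain P' where P': "weak step P [] P'" "\<And>\<mu> P''. \<mu> \<in> X \<Longrightarrow> \<not> weak step P' [\<mu>] P''"
    using assms unfolding must_set_def by blast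
  have "doomed step (test_step (ready_labels X)) passed P' (test [])"
  proof (cases "converges step P'")
    case True
    then obtain P1 where P1: "weak step P' [] P1" "\<And>P2. \<not> step P1 Tau P2"
      using converges_reaches_stable by metis
    have "\<not> reduces step (test_step (ready_labels X)) (P1, test []) x" for x
    proof
      assume "reduces step (test_step (ready_labels X)) (P1, test []) x"
      then show False
      proof cases
        case (server_tau P2)
        then show False using P1 by simp
      next
        case (client_tau r')
        then show False using test_step_Nil_cases[OF client_tau(2)] by (simp add: ready_labels_def)
      next
        case (communication \<mu> P2 r')
        then have "\<mu> \<in> X"
          using test_step_Nil_cases[OF communication(3)] by (cases \<mu>) (auto simp: ready_labels_def)
        moreover have "weak step P' [\<mu>] P2"
          using weak_append[OF P1(1) weak_single[of step, OF communication(2)]]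
          by simp
        ultimately show False using P'(2) by simp
      qed
    qed
    then have "doomed step (test_step (ready_labels X)) passed P1 (test [])"
      using not_passed_test by (rule doomed_stuck[rotated])
    then show ?thesis by (rule doomed_weak_Nil[OF P1(1)])
  qed (rule doomed_divergent, assumption, rule not_passed_test)
  then show ?thesis by (rule doomed_weak_Nil[OF P'(1)])
qed

section \<open>Completeness of the must-set preorder\<close>

text \<open>The must-preorder fixes the type of client states, so the tests have to be copied into
  it; states outside the range of \<open>e\<close> are isolated.\<close>

definition image_step :: "('d \<Rightarrow> 'c) \<Rightarrow> ('d, 'n) trans \<Rightarrow> ('c, 'n) trans" where
  "image_step e step x l y \<longleftrightarrow> (\<exists>u v. x = e u \<and> y = e v \<and> step u l v)"

definition image_good :: "('d \<Rightarrow> 'c) \<Rightarrow> ('d \<Rightarrow> bool) \<Rightarrow> 'c \<Rightarrow> bool" where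
  "image_good e good x \<longleftrightarrow> (\<exists>u. x = e u \<and> good u)"

context
  fixes e :: "'d \<Rightarrow> 'c"
  assumes inj: "inj e"
begin

lemma image_step_iff: "image_step e step (e u) l y \<longleftrightarrow> (\<exists>v. y = e v \<and> step u l v)"
  using inj by (auto simp: image_step_def inj_def)

lemma image_good_iff: "image_good e good (e u) \<longleftrightarrow> good u"
  using inj by (auto simp: image_good_def inj_def)

lemma image_client:
  assumes "client step good"
  shows "client (image_step e step) (image_good e good)"
proof -
  interpret client step good by fact
  have from_image: "\<exists>u. x = e u" if "image_step e step x l y" for x l y
    using that by (auto simp: image_step_def)
  show ?thesis
  proof
    fix p
    show "finite (outputs (image_step e step) p)"
    proof (cases "\<exists>u. p = e u")
      case True
      then obtain u where "p = e u" by blast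
      then have "outputs (image_step e step) p \<subseteq> outputs step u"
        by (auto simp: outputs_def image_step_iff)
      then show ?thesis using finite_outputs by (rule finite_subset)
    next
      case False
      then have "outputs (image_step e step) p = {}"
        using from_image unfolding outputs_def by blast
      then show ?thesis by simp
    qed
  next
    fix p a p' \<alpha> q
    assume "image_step e step p (Vis (Out a)) p'" "image_step e step p' \<alpha> q"
    then obtain u v w where u: "p = e u" "q = e w" "step u (Vis (Out a)) v" "step v \<alpha> w"
      using inj by (auto simp: image_step_def inj_eq)
    from output_commutativity[OF u(3,4)]
    show "\<exists>p''. image_step e step p \<alpha> p'' \<and> image_step e step p'' (Vis (Out a)) q"
      using u(1,2) unfolding image_step_def by blast
  next
    fix p a p' q
    assume "image_step e step p (Vis (Out a)) p'" "image_step e step p' (Vis (In a)) q"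
    then show "image_step e step p Tau q"
      using inj by (auto simp: image_step_def inj_eq dest: feedback)
  next
    fix p a p' p''
    assume "image_step e step p (Vis (Out a)) p'" "image_step e step p (Vis (Out a)) p''"
    then show "p' = p''"
      using inj by (auto simp: image_step_def inj_eq dest: output_determinacy)
  next
    fix p a p' p''
    assume "image_step e step p (Vis (Out a)) p'" "image_step e step p Tau p''"
    then obtain u v w where u: "p = e u" "p' = e v" "p'' = e w"
      "step u (Vis (Out a)) v" "step u Tau w"
      using inj by (auto simp: image_step_def inj_eq)
    from output_tau[OF u(4,5)]
    show "(\<exists>q. image_step e step p' Tau q \<and> image_step e step p'' (Vis (Out a)) q) \<or>
        image_step e step p' (Vis (In a)) p''"
      using u(1-3) unfolding image_step_def by blast
  next
    fix p a p' \<alpha> p''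
    assume "image_step e step p (Vis (Out a)) p'" "image_step e step p \<alpha> p''"
      and \<alpha>: "\<alpha> \<notin> {Vis (Out a), Tau}"
    then obtain u v w where u: "p = e u" "p' = e v" "p'' = e w"
      "step u (Vis (Out a)) v" "step u \<alpha> w"
      using inj by (auto simp: image_step_def inj_eq)
    from output_confluence[OF u(4,5) \<alpha>]
    show "\<exists>q. image_step e step p' \<alpha> q \<and> image_step e step p'' (Vis (Out a)) q"
      using u(1-3) unfolding image_step_def by blast
  next
    fix p a p' p''
    assume "image_step e step p' (Vis (Out a)) p" "image_step e step p'' (Vis (Out a)) p"
    then show "p' = p''"
      using inj by (auto simp: image_step_def inj_eq dest: backward_output_determinacy)
  next
    fix r a r'
    assume "image_step e step r (Vis (Out a)) r'"
    then show "image_good e good r \<longleftrightarrow> image_good e good r'"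
      using good_output by (auto simp: image_step_def image_good_iff)
  next
    show "\<not> (\<exists>f. \<forall>i. \<exists>a. image_step e step (f i) (Vis (Out a)) (f (Suc i)))"
    proof
      assume "\<exists>f. \<forall>i. \<exists>a. image_step e step (f i) (Vis (Out a)) (f (Suc i))"
      then obtain f where f: "\<forall>i. \<exists>a. image_step e step (f i) (Vis (Out a)) (f (Suc i))" by (rule exE)
      then have "\<forall>i. \<exists>u. f i = e u" using from_image by blast
      then obtain g where g: "\<forall>i. f i = e (g i)" by metis
      have "\<forall>i. \<exists>a. step (g i) (Vis (Out a)) (g (Suc i))"
        using f g inj by (simp add: image_step_iff inj_eq)
      then show False using outputs_terminate by (metis (no_types))
    qed
  qed
qed

lemma reduces_image_iff:
  "reduces stepS (image_step e step) (p, e r) (p', y) \<longleftrightarrow>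
    (\<exists>r'. y = e r' \<and> reduces stepS step (p, r) (p', r'))"
  by (auto simp: reduces.simps image_step_iff)

lemma doomed_image_iff:
  "doomed stepS (image_step e step) (image_good e good) p (e r) \<longleftrightarrow> doomed stepS step good p r"
proof
  assume "doomed stepS (image_step e step) (image_good e good) p (e r)"
  then show "doomed stepS step good p r"
  proof (coinduction arbitrary: p r)
    case doomed
    then have "\<not> good r" using doomed_not_good image_good_iff by metis
    from doomed show ?case
    proof cases
      case doomed_stuck
      then have "\<not> reduces stepS step (p, r) x" for x
        using reduces_image_iff by (metis prod.collapse)
      then show ?thesis using \<open>\<not> good r\<close> by simp
    next
      case (doomed_step p' y)
      then obtain r' where "y = e r'" "reduces stepS step (p, r) (p', r')"
        using reduces_image_iff by metis
      then show ?thesis using \<open>\<not> good r\<close> doomed_step(3) by blast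
    qed
  qed
next
  assume "doomed stepS step good p r"
  then show "doomed stepS (image_step e step) (image_good e good) p (e r)"
  proof (coinduction arbitrary: p r)
    case doomed
    then have ng: "\<not> image_good e good (e r)" using doomed_not_good image_good_iff by metis
    from doomed show ?case
    proof cases
      case doomed_stuck
      then have "\<not> reduces stepS (image_step e step) (p, e r) x" for x
        using reduces_image_iff by (metis prod.collapse)
      then show ?thesis using ng by simp
    next
      case (doomed_step p' r')
      then have "reduces stepS (image_step e step) (p, e r) (p', e r')"
        using reduces_image_iff by metis
      then show ?thesis using ng doomed_step(3) by blast
    qed
  qed
qed

lemma must_preorder_doomed:
  fixes step :: "('d, 'n) trans"
  assumes "must_preorder TYPE('c) stepA stepB p q" "client step good"
    "doomed (fw_step stepB) step good (q \<triangleright> {#}) r"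
  shows "doomed (fw_step stepA) step good (p \<triangleright> {#}) r"
proof -
  interpret client step good by fact
  show ?thesis
    using assms(1)[unfolded must_preorder_def, rule_format, OF image_client[OF assms(2)], of "e r"]
      assms(3)
    by (auto simp: must_iff_not_doomed doomed_image_iff doomed_buffer_iff[OF emits_empty])
qed

end

instance act :: (countable) countable
  by countable_datatype

text \<open>Coding a multiset by a chosen list of its elements makes the test states countable, and
  every infinite type contains a copy of the natural numbers.\<close>

lemma test_state_inj:
  assumes "infinite (UNIV :: 'c set)"
  shows "\<exists>e :: 'n::countable act list option \<times> 'n multiset \<Rightarrow> 'c. inj e"
proof -
  obtain h :: "nat \<Rightarrow> 'c" where h: "inj h" using infinite_countable_subset[OF assms] by blast
  obtain enum :: "'n multiset \<Rightarrow> 'n list" where enum: "\<And>M. mset (enum M) = M" using ex_mset by metis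
  have "inj (\<lambda>(k :: 'n act list option, M). h (to_nat (k, enum M)))"
  proof (rule injI, clarify)
    fix k k' :: "'n act list option" and M M'
    assume "h (to_nat (k, enum M)) = h (to_nat (k', enum M'))"
    then have "(k, enum M) = (k', enum M')" using h by (simp add: inj_eq)
    then show "k = k' \<and> M = M'" using enum by (metis prod.inject)
  qed
  then show ?thesis by blast
qed

lemma MS_preorder_if_must_preorder:
  fixes stepA :: "('a, 'n::countable) trans"
  assumes inf: "infinite (UNIV :: 'c set)" and must: "must_preorder TYPE('c) stepA stepB p q"
  shows "MS_preorder (fw_step stepA) (fw_step stepB) (p \<triangleright> {#}) (q \<triangleright> {#})"
proof -
  let ?p = "p \<triangleright> {#}" and ?q = "q \<triangleright> {#}"
  obtain e :: "'n act list option \<times> 'n multiset \<Rightarrow> 'c" where e: "inj e"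
    using test_state_inj[OF inf] by (rule exE)
  have pass: "\<not> doomed (fw_step stepB) (test_step F) passed ?q (test s)"
    if "\<not> doomed (fw_step stepA) (test_step F) passed ?p (test s)" for F s
    using must_preorder_doomed[OF e must test_client] that by blast
  \<comment> \<open>Here \<open>F\<close> is \<open>{Tau}\<close>: the worse server passes the test,
    and a divergence of the better one along \<open>s\<close> would make it fail.\<close>
  have "converges_along (fw_step stepB) ?q s" if "converges_along (fw_step stepA) ?p s" for s
    using pass test_not_doomed[OF that] convergence_test doomed_not_converges_along[OF test_run]
    by metis
  moreover have "must_set (fw_step stepB) q' X"
    if conv: "converges_along (fw_step stepA) ?p s"
      and X: "\<forall>p'\<in>after (fw_step stepA) ?p s. must_set (fw_step stepA) p' X"
      and q': "q' \<in> after (fw_step stepB) ?q s" for s X q'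
  \<comment> \<open>Forwarders accept every input, so a must-set containing one holds trivially and
    only sets of outputs need a test.\<close>
  proof (cases "\<exists>a. In a \<in> X")
    case True
    then obtain a where a: "In a \<in> X" by blast
    have "\<exists>q2. weak (fw_step stepB) q1 [In a] q2" for q1
      using fw_receptive[of stepB q1 a] weak_refl weak_act by metis
    then show ?thesis using a unfolding must_set_def by blast
  next
    case False
    have "\<not> doomed (fw_step stepA) (test_step (ready_labels X)) passed ?p (test s)"
    proof (rule test_not_doomed[OF conv])
      fix p'
      assume "weak (fw_step stepA) ?p s p'" "converges (fw_step stepA) p'"
      then show "\<not> doomed (fw_step stepA) (test_step (ready_labels X)) passed p' (test [])"
        using X False must_set_test[of "fw_step stepA" p' X] by (simp add: after_def)
    qed
    then have "\<not> doomed (fw_step stepB) (test_step (ready_labels X)) passed ?q (test s)"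
      by (rule pass)
    then have "\<not> doomed (fw_step stepB) (test_step (ready_labels X)) passed q' (test [])"
      using doomed_client_run[of "test_step (ready_labels X)" passed "test s" s "test []"
          "fw_step stepB" ?q q'] q' test_run unfolding after_def by blast
    then show ?thesis using not_must_set_doomed by metis
  qed
  ultimately show ?thesis
    unfolding MS_preorder_def cnv_preorder_def M_preorder_def by blast
qed

theorem theorem3:
  fixes stepA :: "('a, 'n::countable) trans"
    and stepB :: "('b, 'n) trans"
    and p :: 'a and q :: 'b
  assumes "Fdb stepA" and "Fdb stepB"
    and "image_finite stepA"
    and "infinite (UNIV :: 'c set)"
  shows "must_preorder TYPE('c) stepA stepB p q \<longleftrightarrow>
    MS_preorder (fw_step stepA) (fw_step stepB) (p \<triangleright> {#}) (q \<triangleright> {#})"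
  by (rule iffI)
    (erule MS_preorder_if_must_preorder[OF assms(4)], erule must_preorder_if_MS_preorder[OF assms(1,3)])

end
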